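(* Let $\Gamma=(G,E)$ be a graph satisfying the standing assumptions listed in the context, with the visual metric $d_\varepsilon$ on $\Gamma\cup\partial\Gamma$, and let $V:\mathbb{R}\to\mathbb{R}$ be a $C^2$ double-well potential with consecutive non-degenerate absolute minima $c_0<c_1$. Let $D_0,D_1\subset\partial\Gamma$ be such that $\overline{D_0\cup D_1}=\partial\Gamma$, $\mathring{D}_0\cap\mathring{D}_1=\varnothing$ and $\overline{\mathring{D}_j}=D_j$ for $j\in\{0,1\}$ (interiors and closures taken in $\partial\Gamma$). Then there exists a global minimiser $x:G\to\mathbb{R}$ such that for every $\kappa>0$ and every $j\in\{0,1\}$ there exists a set $\mathcal{O}_j\subset\Gamma\cup\partial\Gamma$, open with respect to the topology induced by the visual metric, such that $\mathring{D}_j\subset\mathcal{O}_j$ and $|x_g-c_j|\le\kappa$ for every $g\in G\cap\mathcal{O}_j$.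
   Context: Graph. $\Gamma=(G,E)$ is an infinite connected graph with vertex set $G$, and there is $S\in\mathbb{N}$ such that every vertex is joined to at most $S$ edges. Edges have length $1$ and $d$ is the resulting path metric on $\Gamma$. For some $\delta>0$ the space $(\Gamma,d)$ is $\delta$-hyperbolic: in every geodesic triangle each side lies in the $\delta$-neighbourhood of the union of the other two. Boundary. A geodesic ray is an isometric map $\gamma:[0,\infty)\to\Gamma$; rays $\gamma_1,\gamma_2$ are equivalent if $d(\gamma_1(t),\gamma_2(t))$ is bounded in $t\ge0$; $\partial\Gamma$ is the set of equivalence classes. For a vertex $v$ and $\xi\in\partial\Gamma$, $\xi_v\subset G$ is the set of all vertices lying on some geodesic ray starting at $v$ in the class $\xi$. It is assumed that there are a base vertex $v\in G$ and a constant $\bar\delta>0$ such that for every $g\in G$ there is $\xi\in\partial\Gamma$ with $d(g,\xi_v)\le\bar\delta$. Visual metric. For $\varepsilon>0$ and $y,\tilde y\in\Gamma$, $d_\varepsilon(y,\tilde y)=\inf_p\int_0^{l(p)}e^{-\varepsilon d(v,p(s))}\,ds$, the infimum being over paths $p$ in $\Gamma$ from $y$ to $\tilde y$, parametrised by arc length. There is $\varepsilon_0>0$ such that for $0<\varepsilon<\varepsilon_0$, $d_\varepsilon$ extends, by taking limits along geodesic rays representing boundary points, to a metric on $\Gamma\cup\partial\Gamma$, and for some $\lambda>0$, $\lambda^{-1}e^{-\varepsilon d(v,\gamma_{\xi,\mu})}\le d_\varepsilon(\xi,\mu)\le\lambda e^{-\varepsilon d(v,\gamma_{\xi,\mu})}$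 for all distinct $\xi,\mu\in\partial\Gamma$ and every bi-infinite geodesic $\gamma_{\xi,\mu}$ from $\xi$ to $\mu$. Such an $\varepsilon$ is fixed. Isoperimetric condition. Let $\mathcal{B}_n=\{g\in G: d(v,g)\le n\}$ and let $D>0$, $C_D>0$ be constants with $\#\mathcal{B}_n\le C_De^{\varepsilon nD}$ for all $n\in\mathbb{N}$. For $B\subset G$ put $\partial^{\mathrm{out}}B=\{g\in G\setminus B: d(g,B)\le1\}$. It is assumed that there is $C_0\ge1$ such that $C_0\,\#(\partial^{\mathrm{out}}B)\ge(\#B)^{4D/(4D+1)}$ for every finite $B\subset G$. Variational problem. "Consecutive non-degenerate absolute minima" means that $c_0<c_1$ are global minimum points of $V$ with $V''(c_j)\ne 0$ and no other global minimum points between them. For $x:G\to\mathbb{R}$, $|\nabla_g(x)|^2=\sum_{\tilde g:\,d(\tilde g,g)=1}(x_{\tilde g}-x_g)^2$, and the formal action is $W(x)=\sum_{g\in G}\left(\frac14|\nabla_g(x)|^2+V(x_g)\right)$. A function $x$ is a global minimiser if $W(x+y)-W(x)\ge0$ for every finitely supported $y:G\to\mathbb{R}$, where the difference is interpreted as the difference of the sums restricted to any finite set of vertices containing all vertices at distance at most $1$ from the support of $y$. (Global minimisers solve the Allen-Cahn equation $\sum_{d(\tilde g,g)=1}(x_{\tilde g}-x_g)-V'(x_g)=0$ for all $g\in G$.) *)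

theory Defs
  imports "HOL-Analysis.Analysis"
begin

section \<open>Metric graphs\<close>

text \<open>
  A graph is given by its vertex set \<open>G\<close> and its adjacency relation \<open>E\<close>; an undirected edge
  joining \<open>u\<close> and \<open>w\<close> corresponds to the two pairs \<open>(u, w)\<close> and \<open>(w, u)\<close>.
\<close>

definition simple_graph :: "'a set \<Rightarrow> ('a \<times> 'a) set \<Rightarrow> bool" where
  "simple_graph G E \<longleftrightarrow> E \<subseteq> G \<times> G \<and> sym E \<and> irrefl E"

definition connected_graph :: "'a set \<Rightarrow> ('a \<times> 'a) set \<Rightarrow> bool" where
  "connected_graph G E \<longleftrightarrow> (\<forall>g\<in>G. \<forall>h\<in>G. (g, h) \<in> E\<^sup>*)"

definition degree_at_most :: "nat \<Rightarrow> 'a set \<Rightarrow> ('a \<times> 'a) set \<Rightarrow> bool" where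
  "degree_at_most S G E \<longleftrightarrow> (\<forall>g\<in>G. finite (E `` {g}) \<and> card (E `` {g}) \<le> S)"

text \<open>
  Points of the metric graph are represented by their barycentric coordinates, i.e. by functions
  on the vertices: \<open>edge_point u w t\<close> is the point of the edge from \<open>u\<close> to \<open>w\<close> at distance \<open>t\<close>
  from \<open>u\<close>. Thus \<open>edge_point u w t = edge_point w u (1 - t)\<close>, and edges meet in vertices only.
\<close>

type_synonym 'a point = "'a \<Rightarrow> real"

definition vert :: "'a \<Rightarrow> 'a point" where
  "vert g = indicator {g}"

definition edge_point :: "'a \<Rightarrow> 'a \<Rightarrow> real \<Rightarrow> 'a point" where
  "edge_point u w t = (\<lambda>h. (1 - t) * vert u h + t * vert w h)"

definition metric_graph :: "'a set \<Rightarrow> ('a \<times> 'a) set \<Rightarrow> 'a point set" where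
  "metric_graph G E = vert ` G \<union> {edge_point u w t |u w t. (u, w) \<in> E \<and> t \<in> {0..1}}"

text \<open>
  \<open>pl_path G E p q r\<close>: there is a piecewise linear path of length \<open>r\<close> from \<open>p\<close> to \<open>q\<close>, edges
  having length 1.
\<close>

inductive pl_path :: "'a set \<Rightarrow> ('a \<times> 'a) set \<Rightarrow> 'a point \<Rightarrow> 'a point \<Rightarrow> real \<Rightarrow> bool"
  for G E where
  refl: "p \<in> metric_graph G E \<Longrightarrow> pl_path G E p p 0"
| step: "pl_path G E p (edge_point u w s) r \<Longrightarrow> (u, w) \<in> E \<Longrightarrow> s \<in> {0..1} \<Longrightarrow> t \<in> {0..1}
    \<Longrightarrow> pl_path G E p (edge_point u w t) (r + \<bar>t - s\<bar>)"

definition path_dist :: "'a set \<Rightarrow> ('a \<times> 'a) set \<Rightarrow> 'a point \<Rightarrow> 'a point \<Rightarrow> real" where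
  "path_dist G E p q = Inf {r. pl_path G E p q r}"

definition vdist :: "'a set \<Rightarrow> ('a \<times> 'a) set \<Rightarrow> 'a \<Rightarrow> 'a \<Rightarrow> real" where
  "vdist G E g h = path_dist G E (vert g) (vert h)"


section \<open>Geodesics and hyperbolicity\<close>

text \<open>Curves are total functions, of which only the values on the interval \<open>I\<close> are relevant.\<close>

definition geodesic_on :: "'a set \<Rightarrow> ('a \<times> 'a) set \<Rightarrow> real set \<Rightarrow> (real \<Rightarrow> 'a point) \<Rightarrow> bool" where
  "geodesic_on G E I c \<longleftrightarrow>
     c ` I \<subseteq> metric_graph G E \<and> (\<forall>s\<in>I. \<forall>t\<in>I. path_dist G E (c s) (c t) = \<bar>s - t\<bar>)"

definition geodesic_segment ::
    "'a set \<Rightarrow> ('a \<times> 'a) set \<Rightarrow> 'a point \<Rightarrow> 'a point \<Rightarrow> 'a point set \<Rightarrow> bool" where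
  "geodesic_segment G E p q A \<longleftrightarrow>
     (\<exists>c l. 0 \<le> l \<and> geodesic_on G E {0..l} c \<and> c 0 = p \<and> c l = q \<and> A = c ` {0..l})"

text \<open>
  As the triangle is arbitrary, it suffices to state the condition for one of its three sides.
\<close>

definition hyperbolic :: "real \<Rightarrow> 'a set \<Rightarrow> ('a \<times> 'a) set \<Rightarrow> bool" where
  "hyperbolic \<delta> G E \<longleftrightarrow>
     (\<forall>p q r A B C. geodesic_segment G E p q A \<longrightarrow> geodesic_segment G E q r B \<longrightarrow>
        geodesic_segment G E r p C \<longrightarrow> (\<forall>a\<in>A. \<exists>b\<in>B \<union> C. path_dist G E a b \<le> \<delta>))"


section \<open>The boundary at infinity\<close>

definition rays :: "'a set \<Rightarrow> ('a \<times> 'a) set \<Rightarrow> (real \<Rightarrow> 'a point) set" where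
  "rays G E = {\<gamma>. geodesic_on G E {0..} \<gamma>}"

definition ray_equiv ::
    "'a set \<Rightarrow> ('a \<times> 'a) set \<Rightarrow> ((real \<Rightarrow> 'a point) \<times> (real \<Rightarrow> 'a point)) set" where
  "ray_equiv G E = {(\<gamma>\<^sub>1, \<gamma>\<^sub>2). \<gamma>\<^sub>1 \<in> rays G E \<and> \<gamma>\<^sub>2 \<in> rays G E \<and>
     (\<exists>K. \<forall>t\<ge>0. path_dist G E (\<gamma>\<^sub>1 t) (\<gamma>\<^sub>2 t) \<le> K)}"

type_synonym 'a bpoint = "(real \<Rightarrow> 'a point) set"

definition boundary :: "'a set \<Rightarrow> ('a \<times> 'a) set \<Rightarrow> 'a bpoint set" where
  "boundary G E = rays G E // ray_equiv G E"

text \<open>The set \<open>\<xi>\<^sub>v\<close> of vertices on geodesic rays from \<open>v\<close> in the class \<open>\<xi>\<close>.\<close>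

definition ray_vertices :: "'a set \<Rightarrow> 'a \<Rightarrow> 'a bpoint \<Rightarrow> 'a set" where
  "ray_vertices G v \<xi> = {g \<in> G. \<exists>\<gamma>\<in>\<xi>. \<gamma> 0 = vert v \<and> (\<exists>t\<ge>0. \<gamma> t = vert g)}"

text \<open>
  Distances between vertices are integers, so the distance from a vertex to a nonempty set of
  vertices is attained; distance conditions on such sets are written with an existential quantifier.
\<close>

definition coarsely_covered_by_rays :: "'a set \<Rightarrow> ('a \<times> 'a) set \<Rightarrow> 'a \<Rightarrow> real \<Rightarrow> bool" where
  "coarsely_covered_by_rays G E v \<delta>' \<longleftrightarrow>
     (\<forall>g\<in>G. \<exists>\<xi>\<in>boundary G E. \<exists>h\<in>ray_vertices G v \<xi>. vdist G E g h \<le> \<delta>')"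


section \<open>The visual metric\<close>

definition curve_length :: "('b \<Rightarrow> 'b \<Rightarrow> real) \<Rightarrow> (real \<Rightarrow> 'b) \<Rightarrow> real \<Rightarrow> real \<Rightarrow> ereal" where
  "curve_length dst c a b =
     Sup {ereal (\<Sum>i<n. dst (c (s i)) (c (s (Suc i)))) |(n::nat) s.
       s 0 = a \<and> s n = b \<and> (\<forall>i<n. s i \<le> s (Suc i))}"

text \<open>
  \<open>arclength_path G E p q l c\<close>: \<open>c\<close> is a path on \<open>{0..l}\<close> from \<open>p\<close> to \<open>q\<close> parametrised by arc
  length (in particular 1-Lipschitz, hence continuous).
\<close>

definition arclength_path ::
    "'a set \<Rightarrow> ('a \<times> 'a) set \<Rightarrow> 'a point \<Rightarrow> 'a point \<Rightarrow> real \<Rightarrow> (real \<Rightarrow> 'a point) \<Rightarrow> bool" where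
  "arclength_path G E p q l c \<longleftrightarrow>
     0 \<le> l \<and> c ` {0..l} \<subseteq> metric_graph G E \<and> c 0 = p \<and> c l = q \<and>
     (\<forall>a b. 0 \<le> a \<and> a \<le> b \<and> b \<le> l \<longrightarrow> curve_length (path_dist G E) c a b = ereal (b - a))"

definition visual_dist ::
    "'a set \<Rightarrow> ('a \<times> 'a) set \<Rightarrow> 'a \<Rightarrow> real \<Rightarrow> 'a point \<Rightarrow> 'a point \<Rightarrow> real" where
  "visual_dist G E v \<epsilon> p q =
     Inf {integral {0..l} (\<lambda>s. exp (- \<epsilon> * path_dist G E (vert v) (c s))) |l c.
       arclength_path G E p q l c}"

definition compactification :: "'a set \<Rightarrow> ('a \<times> 'a) set \<Rightarrow> ('a point + 'a bpoint) set" where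
  "compactification G E = metric_graph G E <+> boundary G E"

text \<open>
  \<open>visual_extension G E v \<epsilon> \<rho>\<close>: the distance defined by \<open>\<epsilon>\<close> extends, by taking limits along rays,
  to the metric \<open>\<rho>\<close>. These conditions determine \<open>\<rho>\<close> on the compactification.
\<close>

definition visual_extension ::
    "'a set \<Rightarrow> ('a \<times> 'a) set \<Rightarrow> 'a \<Rightarrow> real \<Rightarrow>
     ('a point + 'a bpoint \<Rightarrow> 'a point + 'a bpoint \<Rightarrow> real) \<Rightarrow> bool" where
  "visual_extension G E v \<epsilon> \<rho> \<longleftrightarrow>
     Metric_space (compactification G E) \<rho> \<and>
     (\<forall>p\<in>metric_graph G E. \<forall>q\<in>metric_graph G E.
        \<rho> (Inl p) (Inl q) = visual_dist G E v \<epsilon> p q) \<and>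
     (\<forall>p\<in>metric_graph G E. \<forall>\<xi>\<in>boundary G E. \<forall>\<gamma>\<in>\<xi>.
        ((\<lambda>t. visual_dist G E v \<epsilon> p (\<gamma> t)) \<longlongrightarrow> \<rho> (Inl p) (Inr \<xi>)) at_top) \<and>
     (\<forall>\<xi>\<in>boundary G E. \<forall>\<mu>\<in>boundary G E. \<forall>\<gamma>\<in>\<xi>. \<forall>\<eta>\<in>\<mu>.
        ((\<lambda>t. visual_dist G E v \<epsilon> (\<gamma> t) (\<eta> t)) \<longlongrightarrow> \<rho> (Inr \<xi>) (Inr \<mu>)) at_top)"

definition biinfinite_geodesic ::
    "'a set \<Rightarrow> ('a \<times> 'a) set \<Rightarrow> 'a bpoint \<Rightarrow> 'a bpoint \<Rightarrow> (real \<Rightarrow> 'a point) \<Rightarrow> bool" where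
  "biinfinite_geodesic G E \<xi> \<mu> \<gamma> \<longleftrightarrow>
     geodesic_on G E UNIV \<gamma> \<and> (\<lambda>t. \<gamma> (- t)) \<in> \<xi> \<and> \<gamma> \<in> \<mu>"

definition visual_estimate ::
    "'a set \<Rightarrow> ('a \<times> 'a) set \<Rightarrow> 'a \<Rightarrow> real \<Rightarrow> real \<Rightarrow>
     ('a point + 'a bpoint \<Rightarrow> 'a point + 'a bpoint \<Rightarrow> real) \<Rightarrow> bool" where
  "visual_estimate G E v \<epsilon> L \<rho> \<longleftrightarrow>
     (\<forall>\<xi>\<in>boundary G E. \<forall>\<mu>\<in>boundary G E. \<forall>\<gamma>. \<xi> \<noteq> \<mu> \<longrightarrow> biinfinite_geodesic G E \<xi> \<mu> \<gamma> \<longrightarrow>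
        (let r = (INF t. path_dist G E (vert v) (\<gamma> t)) in
          inverse L * exp (- \<epsilon> * r) \<le> \<rho> (Inr \<xi>) (Inr \<mu>) \<and>
          \<rho> (Inr \<xi>) (Inr \<mu>) \<le> L * exp (- \<epsilon> * r)))"

definition compactification_topology ::
    "'a set \<Rightarrow> ('a \<times> 'a) set \<Rightarrow> ('a point + 'a bpoint \<Rightarrow> 'a point + 'a bpoint \<Rightarrow> real)
     \<Rightarrow> ('a point + 'a bpoint) topology" where
  "compactification_topology G E \<rho> = Metric_space.mtopology (compactification G E) \<rho>"

definition boundary_topology ::
    "'a set \<Rightarrow> ('a \<times> 'a) set \<Rightarrow> ('a point + 'a bpoint \<Rightarrow> 'a point + 'a bpoint \<Rightarrow> real)
     \<Rightarrow> 'a bpoint topology" where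
  "boundary_topology G E \<rho> =
     Metric_space.mtopology (boundary G E) (\<lambda>\<xi> \<mu>. \<rho> (Inr \<xi>) (Inr \<mu>))"


section \<open>Growth and isoperimetry\<close>

definition vball :: "'a set \<Rightarrow> ('a \<times> 'a) set \<Rightarrow> 'a \<Rightarrow> nat \<Rightarrow> 'a set" where
  "vball G E v n = {g \<in> G. vdist G E v g \<le> real n}"

definition outer_boundary :: "'a set \<Rightarrow> ('a \<times> 'a) set \<Rightarrow> 'a set \<Rightarrow> 'a set" where
  "outer_boundary G E B = {g \<in> G - B. \<exists>b\<in>B. vdist G E g b \<le> 1}"


section \<open>The variational problem\<close>

definition C2 :: "(real \<Rightarrow> real) \<Rightarrow> bool" where
  "C2 V \<longleftrightarrow> (\<forall>s. V differentiable (at s)) \<and> (\<forall>s. deriv V differentiable (at s)) \<and>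
     continuous_on UNIV (deriv (deriv V))"

definition global_min_point :: "(real \<Rightarrow> real) \<Rightarrow> real \<Rightarrow> bool" where
  "global_min_point V a \<longleftrightarrow> (\<forall>s. V a \<le> V s)"

definition consecutive_nondegenerate_minima :: "(real \<Rightarrow> real) \<Rightarrow> real \<Rightarrow> real \<Rightarrow> bool" where
  "consecutive_nondegenerate_minima V a b \<longleftrightarrow>
     a < b \<and> global_min_point V a \<and> global_min_point V b \<and>
     deriv (deriv V) a \<noteq> 0 \<and> deriv (deriv V) b \<noteq> 0 \<and>
     (\<forall>s. a < s \<and> s < b \<longrightarrow> \<not> global_min_point V s)"

definition grad_sq :: "'a set \<Rightarrow> ('a \<times> 'a) set \<Rightarrow> ('a \<Rightarrow> real) \<Rightarrow> 'a \<Rightarrow> real" where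
  "grad_sq G E x g = (\<Sum>h\<in>{h \<in> G. vdist G E h g = 1}. (x h - x g)\<^sup>2)"

definition action_on ::
    "'a set \<Rightarrow> ('a \<times> 'a) set \<Rightarrow> (real \<Rightarrow> real) \<Rightarrow> 'a set \<Rightarrow> ('a \<Rightarrow> real) \<Rightarrow> real" where
  "action_on G E V F x = (\<Sum>g\<in>F. 1 / 4 * grad_sq G E x g + V (x g))"

definition support_nhd :: "'a set \<Rightarrow> ('a \<times> 'a) set \<Rightarrow> ('a \<Rightarrow> real) \<Rightarrow> 'a set" where
  "support_nhd G E y = {g \<in> G. \<exists>h\<in>G. y h \<noteq> 0 \<and> vdist G E g h \<le> 1}"

text \<open>Functions on \<open>G\<close> are total functions whose values outside \<open>G\<close> are irrelevant.\<close>

definition global_minimiser ::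
    "'a set \<Rightarrow> ('a \<times> 'a) set \<Rightarrow> (real \<Rightarrow> real) \<Rightarrow> ('a \<Rightarrow> real) \<Rightarrow> bool" where
  "global_minimiser G E V x \<longleftrightarrow>
     (\<forall>y F. finite {g \<in> G. y g \<noteq> 0} \<longrightarrow> finite F \<longrightarrow> F \<subseteq> G \<longrightarrow> support_nhd G E y \<subseteq> F \<longrightarrow>
        action_on G E V F (\<lambda>g. x g + y g) - action_on G E V F x \<ge> 0)"

end

theory Submission
  imports Defs
begin

text \<open>
  The minimiser is a limit of minimisers on finite sets \<open>P\<close> of vertices. On \<open>P\<close> the action is minimised
  among functions with values in \<open>[c\<^sub>0, c\<^sub>1]\<close>, the value outside \<open>P\<close> being \<open>c\<^sub>j\<close> at the vertices that
  the visual metric places near the interior of \<open>D\<^sub>j\<close>. Cutting a competitor off at \<open>c\<^sub>0\<close> and \<open>c\<^sub>1\<close> does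
  not increase the action, so such a function also minimises against arbitrary perturbations supported
  in \<open>P\<close> (\<open>minimiser_on_exists\<close>). A set of functions defined by closed conditions on single values
  survives the passage to the limit, by compactness of \<open>[c\<^sub>0, c\<^sub>1]\<close> to the power of the vertex set
  (\<open>global_minimiser_from_finite\<close>). What has to be shown is that minimisers on \<open>P\<close> are close to \<open>c\<^sub>j\<close> in
  a visual neighbourhood of each interior point \<open>\<xi>\<close> of \<open>D\<^sub>j\<close> whose size does not depend on \<open>P\<close>
  (\<open>minimiser_decay_radius\<close>).

  Write \<open>a\<close> for \<open>c\<^sub>j\<close>, \<open>u\<close> for the visual distance from \<open>\<xi>\<close> and \<open>A\<close> for the set of \<open>g \<in> P\<close> with
  \<open>u g < r\<close>. Resetting a minimiser \<open>x\<close> to the value \<open>a\<close> on \<open>A\<close> must not lower the action; hence the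
  energy of \<open>x\<close> in \<open>A\<close> is at most a multiple of \<open>s(r)\<close>, the sum of \<open>(x - a)\<^sup>2\<close> over the outer boundary of
  \<open>A\<close> (\<open>cutoff_inequality\<close>). The energy controls the sum \<open>M(r)\<close> of \<open>(x - a)\<^sup>2\<close> over the part of \<open>A\<close>
  where \<open>x\<close> is in the well of \<open>a\<close>. The rest of \<open>A\<close> has an outer boundary each vertex of which carries
  a fixed amount of energy or of boundary mass (\<open>deviation_boundary_count\<close>), so the isoperimetric inequality bounds its size. Altogether
  \<open>M(r) \<le> K\<^sub>1 s(r) + K\<^sub>2 s(r)\<^sup>1\<^sup>/\<^sup>\<alpha>\<close> with \<open>\<alpha> = 4 D / (4 D + 1)\<close> (\<open>mass_le_boundary_mass\<close>).

  On the other hand an edge at distance \<open>n\<close> from \<open>v\<close> has visual length at most a multiple of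
  \<open>e\<^sup>-\<^sup>\<epsilon>\<^sup>n\<close>, while there are at most \<open>C\<^sub>D e\<^sup>\<epsilon>\<^sup>n\<^sup>D\<close> vertices within distance \<open>n\<close>. If \<open>M(r)\<close> is large, then
  \<open>s(r)\<close> is at least of order \<open>M(r)\<^sup>\<alpha>\<close>, and half of it must come from vertices so far from \<open>v\<close> that
  they lie within visual distance \<open>\<tau>\<close>, of order \<open>M(r)\<close> to the power \<open>- \<alpha> / D\<close>, of the sphere \<open>u = r\<close>.
  So \<open>M(r + \<tau>) \<ge> M(r) + const M(r)\<^sup>\<alpha>\<close>, a discrete version of \<open>M' \<ge> const M\<^sup>p\<close> with
  \<open>p = \<alpha> + \<alpha> / D = 1 + 3 / (4 D + 1)\<close>. Since \<open>p > 1\<close>, the mass \<open>M\<close> would become infinite at a finite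
  radius, although \<open>P\<close> is finite. Therefore \<open>M\<close> is bounded by a constant at a fixed radius; and as the
  visual length of edges near \<open>\<xi>\<close> tends to 0, a deviation from \<open>a\<close> of size \<open>\<kappa>\<close> at a vertex very close
  to \<open>\<xi>\<close> would reach that constant in many small steps (\<open>mass_decay_radius\<close>).
\<close>

section \<open>Distances in metric graphs\<close>

lemma vert_eq_edge_point: "vert u = edge_point u w 0" "vert w = edge_point u w 1"
  by (auto simp: edge_point_def)

lemma edge_point_in_metric_graph:
  "(u, w) \<in> E \<Longrightarrow> t \<in> {0..1} \<Longrightarrow> edge_point u w t \<in> metric_graph G E"
  by (auto simp: metric_graph_def)

lemma vert_in_metric_graph: "g \<in> G \<Longrightarrow> vert g \<in> metric_graph G E"
  by (auto simp: metric_graph_def)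

lemma pl_path_edge:
  assumes "(u, w) \<in> E" "s \<in> {0..1}" "t \<in> {0..1}"
  shows "pl_path G E (edge_point u w s) (edge_point u w t) \<bar>t - s\<bar>"
  using pl_path.step[OF pl_path.refl[OF edge_point_in_metric_graph[OF assms(1,2)]] assms] by simp

lemma pl_path_trans:
  assumes "pl_path G E q q' r'" "pl_path G E p q r"
  shows "pl_path G E p q' (r + r')"
  using assms
proof (induction rule: pl_path.induct)
  case (step q u w s r' t)
  then show ?case using pl_path.step[of G E p u w s "r + r'" t] by (simp add: add.assoc)
qed simp

lemma pl_path_sym: "pl_path G E p q r \<Longrightarrow> pl_path G E q p r"
proof (induction rule: pl_path.induct)
  case (step p u w s r t)
  show ?case
    using pl_path_trans[OF step.IH pl_path_edge[OF step.hyps(2) step.hyps(4,3)]]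
    by (simp add: abs_minus_commute add.commute)
qed (rule pl_path.refl)

lemma pl_path_nonneg: "pl_path G E p q r \<Longrightarrow> 0 \<le> r"
  by (induction rule: pl_path.induct) auto

text \<open>
  Lower bounds for distances come from functions that are 1-Lipschitz along every edge.
\<close>

lemma pl_path_Lipschitz:
  fixes F :: "'a point \<Rightarrow> real"
  assumes "\<And>u w s t. (u, w) \<in> E \<Longrightarrow> s \<in> {0..1} \<Longrightarrow> t \<in> {0..1} \<Longrightarrow>
      \<bar>F (edge_point u w t) - F (edge_point u w s)\<bar> \<le> \<bar>t - s\<bar>"
    and "pl_path G E p q r"
  shows "\<bar>F q - F p\<bar> \<le> r"
  using assms(2)
proof (induction rule: pl_path.induct)
  case (step p u w s r t)
  then show ?case using assms(1)[OF step.hyps(2-4)] by linarith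
qed simp

lemma path_dist_le: "pl_path G E p q r \<Longrightarrow> path_dist G E p q \<le> r"
  unfolding path_dist_def by (rule cInf_lower) (auto intro!: bdd_belowI pl_path_nonneg)

lemma path_dist_sym: "path_dist G E p q = path_dist G E q p"
proof -
  have "pl_path G E p q = pl_path G E q p" using pl_path_sym by (intro ext) blast
  then show ?thesis by (simp add: path_dist_def)
qed

lemma path_dist_refl: "p \<in> metric_graph G E \<Longrightarrow> path_dist G E p p = 0"
  unfolding path_dist_def
  by (rule cInf_eq_minimum) (auto intro: pl_path.refl pl_path_nonneg)

lemma pl_path_vertices:
  assumes "simple_graph G E" "(g, h) \<in> E\<^sup>*" "g \<in> G"
  shows "\<exists>r. pl_path G E (vert g) (vert h) r"
  using assms(2)
proof (induction rule: rtrancl_induct)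
  case base
  then show ?case using assms(3) by (auto intro: pl_path.refl vert_in_metric_graph)
next
  case (step y z)
  then obtain r where "pl_path G E (vert g) (edge_point y z 0) r"
    by (auto simp flip: vert_eq_edge_point(1))
  from pl_path.step[OF this step.hyps(2), of 1] show ?case
    by (auto simp flip: vert_eq_edge_point(2))
qed

lemma pl_path_exists:
  assumes "simple_graph G E" "connected_graph G E" "p \<in> metric_graph G E" "q \<in> metric_graph G E"
  shows "\<exists>r. pl_path G E p q r"
proof -
  have *: "\<exists>g\<in>G. \<exists>r. pl_path G E (vert g) p r" if p: "p \<in> metric_graph G E" for p
  proof -
    consider g where "g \<in> G" "p = vert g"
      | u w t where "(u, w) \<in> E" "t \<in> {0..1}" "p = edge_point u w t"
      using p by (auto simp: metric_graph_def)
    then show ?thesis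
    proof cases
      case 1
      then show ?thesis by (auto intro: pl_path.refl vert_in_metric_graph)
    next
      case 2
      then have "u \<in> G" using assms(1) by (auto simp: simple_graph_def)
      moreover have "pl_path G E (vert u) p \<bar>t - 0\<bar>"
        using pl_path_edge[OF 2(1), of 0 t G] 2(2) by (simp add: 2(3) flip: vert_eq_edge_point(1))
      ultimately show ?thesis by blast
    qed
  qed
  obtain g h r r' where "g \<in> G" "h \<in> G" and r: "pl_path G E (vert g) p r" "pl_path G E (vert h) q r'"
    using *[OF assms(3)] *[OF assms(4)] by blast
  then obtain r'' where "pl_path G E (vert g) (vert h) r''"
    using pl_path_vertices[OF assms(1), of g h] assms(2) by (auto simp: connected_graph_def)
  then show ?thesis using pl_path_trans[OF pl_path_trans[OF r(2)]] pl_path_sym[OF r(1)] by blast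
qed

lemma path_dist_triangle:
  assumes "simple_graph G E" "connected_graph G E"
    and "p \<in> metric_graph G E" "q \<in> metric_graph G E" "z \<in> metric_graph G E"
  shows "path_dist G E p z \<le> path_dist G E p q + path_dist G E q z"
proof -
  have "path_dist G E p z - path_dist G E q z \<le> r" if r: "pl_path G E p q r" for r
  proof -
    have "path_dist G E p z - r \<le> r'" if "pl_path G E q z r'" for r'
      using path_dist_le[OF pl_path_trans[OF that r]] by simp
    then have "path_dist G E p z - r \<le> path_dist G E q z"
      unfolding path_dist_def[of G E q z] using pl_path_exists[OF assms(1,2,4,5)]
      by (intro cInf_greatest) auto
    then show ?thesis by simp
  qed
  then have "path_dist G E p z - path_dist G E q z \<le> path_dist G E p q"
    unfolding path_dist_def[of G E p q] using pl_path_exists[OF assms(1-4)]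
    by (intro cInf_greatest) auto
  then show ?thesis by simp
qed

lemma path_dist_ge_Lipschitz:
  fixes F :: "'a point \<Rightarrow> real"
  assumes "\<And>u w s t. (u, w) \<in> E \<Longrightarrow> s \<in> {0..1} \<Longrightarrow> t \<in> {0..1} \<Longrightarrow>
      \<bar>F (edge_point u w t) - F (edge_point u w s)\<bar> \<le> \<bar>t - s\<bar>"
    and "simple_graph G E" "connected_graph G E" "p \<in> metric_graph G E" "q \<in> metric_graph G E"
  shows "\<bar>F q - F p\<bar> \<le> path_dist G E p q"
  unfolding path_dist_def using pl_path_exists[OF assms(2-5)] pl_path_Lipschitz[of E F, OF assms(1)]
  by (intro cInf_greatest) auto

text \<open>
  The barycentric coordinate of a point at a vertex is 1-Lipschitz, so an edge is a geodesic.
\<close>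

lemma path_dist_edge:
  assumes "simple_graph G E" "connected_graph G E" "(u, w) \<in> E" "s \<in> {0..1}" "t \<in> {0..1}"
  shows "path_dist G E (edge_point u w s) (edge_point u w t) = \<bar>t - s\<bar>"
proof (rule antisym)
  show "path_dist G E (edge_point u w s) (edge_point u w t) \<le> \<bar>t - s\<bar>"
    by (intro path_dist_le pl_path_edge assms)
  have ne: "a \<noteq> b" if "(a, b) \<in> E" for a b using assms(1) that by (auto simp: simple_graph_def irrefl_def)
  have "\<bar>edge_point u w t w - edge_point u w s w\<bar> \<le>
      path_dist G E (edge_point u w s) (edge_point u w t)"
    using ne by (intro path_dist_ge_Lipschitz[where F = "\<lambda>p. p w"] assms edge_point_in_metric_graph)
      (auto simp: edge_point_def vert_def indicator_def)
  then show "\<bar>t - s\<bar> \<le> path_dist G E (edge_point u w s) (edge_point u w t)"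
    using ne[OF assms(3)] by (simp add: edge_point_def vert_def)
qed

text \<open>
  The affine extension of this number to the edges is 1-Lipschitz, so \<open>vdist\<close> is at least as large.
  This is how a bound on \<open>vdist\<close> yields a chain of edges.
\<close>

definition edge_count :: "('a \<times> 'a) set \<Rightarrow> 'a \<Rightarrow> 'a \<Rightarrow> nat" where
  "edge_count E g h = (LEAST n. (g, h) \<in> E ^^ n)"

lemma edge_count_relpow: "(g, h) \<in> E\<^sup>* \<Longrightarrow> (g, h) \<in> E ^^ edge_count E g h"
  unfolding edge_count_def by (metis LeastI_ex rtrancl_imp_relpow)

lemma edge_count_step:
  assumes "(g, h) \<in> E\<^sup>*" "(h, k) \<in> E"
  shows "edge_count E g k \<le> Suc (edge_count E g h)"
  unfolding edge_count_def[of E g k]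
  using edge_count_relpow[OF assms(1)] assms(2) by (intro Least_le) auto

lemma edge_count_le_vdist:
  assumes G: "simple_graph G E" "connected_graph G E" and "g \<in> G" "h \<in> G"
  shows "real (edge_count E g h) \<le> vdist G E g h"
proof -
  define f where "f k = real (edge_count E g k)" for k
  define F where "F p = (\<Sum>k | p k \<noteq> 0. p k * f k)" for p :: "'a point"
  have Fe: "F (edge_point u w t) = (1 - t) * f u + t * f w" if "u \<noteq> w" for u w t
  proof -
    have "F (edge_point u w t) = (\<Sum>k\<in>{u, w}. edge_point u w t k * f k)"
      unfolding F_def by (rule sum.mono_neutral_left)
        (auto simp: edge_point_def vert_def indicator_def split: if_splits)
    then show ?thesis using that by (simp add: edge_point_def vert_def)
  qed
  have Fv: "F (vert k) = f k" for k
  proof -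
    have "F (vert k) = (\<Sum>k\<in>{k}. vert k k * f k)"
      unfolding F_def by (rule sum.mono_neutral_cong_left) (auto simp: vert_def indicator_def)
    then show ?thesis by (simp add: vert_def)
  qed
  have lip: "\<bar>f w - f u\<bar> \<le> 1" if "(u, w) \<in> E" for u w
  proof -
    have "(w, u) \<in> E" "u \<in> G" "w \<in> G" using that G by (auto simp: simple_graph_def sym_def)
    then have "(g, u) \<in> E\<^sup>*" "(g, w) \<in> E\<^sup>*" using assms by (auto simp: connected_graph_def)
    then have "edge_count E g w \<le> Suc (edge_count E g u)" "edge_count E g u \<le> Suc (edge_count E g w)"
      using that \<open>(w, u) \<in> E\<close> by (auto intro: edge_count_step)
    then show ?thesis unfolding f_def by linarith
  qed
  have "\<bar>F (edge_point u w t) - F (edge_point u w s)\<bar> \<le> \<bar>t - s\<bar>" if "(u, w) \<in> E" for u w s t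
  proof -
    have "u \<noteq> w" using that G by (auto simp: simple_graph_def irrefl_def)
    then have "F (edge_point u w t) - F (edge_point u w s) = (t - s) * (f w - f u)"
      by (simp add: Fe algebra_simps)
    then show ?thesis using mult_left_mono[OF lip[OF that], of "\<bar>t - s\<bar>"] by (simp add: abs_mult)
  qed
  then have "\<bar>F (vert h) - F (vert g)\<bar> \<le> vdist G E g h"
    unfolding vdist_def using assms by (intro path_dist_ge_Lipschitz vert_in_metric_graph) auto
  moreover have "f g = 0" unfolding f_def edge_count_def by (simp add: Least_eq_0)
  ultimately show ?thesis by (simp add: Fv f_def)
qed

lemma vdist_edge:
  assumes "simple_graph G E" "connected_graph G E" "(g, h) \<in> E"
  shows "vdist G E g h = 1"
  using path_dist_edge[OF assms, of 0 1] by (simp add: vdist_def vert_eq_edge_point[symmetric])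

lemma vdist_le_1:
  assumes "simple_graph G E" "connected_graph G E" "g \<in> G" "h \<in> G"
  shows "vdist G E g h \<le> 1 \<longleftrightarrow> g = h \<or> (g, h) \<in> E"
proof
  assume "vdist G E g h \<le> 1"
  then have "edge_count E g h \<le> 1" using edge_count_le_vdist[OF assms] by linarith
  then have "edge_count E g h = 0 \<or> edge_count E g h = 1" by linarith
  moreover have "(g, h) \<in> E ^^ edge_count E g h"
    using assms by (intro edge_count_relpow) (auto simp: connected_graph_def)
  ultimately show "g = h \<or> (g, h) \<in> E" by auto
next
  assume "g = h \<or> (g, h) \<in> E"
  then show "vdist G E g h \<le> 1"
    using vdist_edge[OF assms(1,2)] path_dist_refl[OF vert_in_metric_graph[OF assms(3)], of E] 
    by (auto simp: vdist_def)
qed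

lemma vdist_sym: "vdist G E g h = vdist G E h g"
  by (simp add: vdist_def path_dist_sym)

lemma vdist_eq_1:
  assumes "simple_graph G E" "connected_graph G E" "g \<in> G"
  shows "{h \<in> G. vdist G E h g = 1} = E `` {g}"
proof -
  have "(g, h) \<in> E" if "h \<in> G" "vdist G E h g = 1" for h
  proof -
    have "h \<noteq> g" using that path_dist_refl[OF vert_in_metric_graph[OF that(1)], of E]
      by (auto simp: vdist_def)
    then show ?thesis using vdist_le_1[OF assms(1-3) that(1)] that vdist_sym[of G E g h] by auto
  qed
  moreover have "h \<in> G \<and> vdist G E h g = 1" if "(g, h) \<in> E" for h
    using vdist_edge[OF assms(1,2) that] assms(1) that vdist_sym[of G E g h]
    by (auto simp: simple_graph_def)
  ultimately show ?thesis by auto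
qed

lemma outer_boundary_eq:
  assumes "simple_graph G E" "connected_graph G E" "B \<subseteq> G"
  shows "outer_boundary G E B = E `` B - B"
proof -
  have "vdist G E g b \<le> 1 \<longleftrightarrow> (b, g) \<in> E" if "g \<in> G - B" "b \<in> B" for g b
    using that assms vdist_le_1[OF assms(1,2), of b g] vdist_sym[of G E g b] by auto
  then show ?thesis using assms(1) by (fastforce simp: outer_boundary_def simple_graph_def)
qed

lemma finite_vball:
  assumes G: "simple_graph G E" "connected_graph G E" and "degree_at_most S G E" "v \<in> G"
  shows "finite (vball G E v n)"
proof -
  have fin: "finite ((E ^^ k) `` {v})" for k
  proof (induction k)
    case (Suc k)
    have "(E ^^ Suc k) `` {v} = (\<Union>g\<in>(E ^^ k) `` {v}. E `` {g})" by auto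
    moreover have "(E ^^ k) `` {v} \<subseteq> G"
      using G(1) assms(4) by (cases k) (auto simp: simple_graph_def)
    ultimately show ?case using Suc assms(3) by (auto simp: degree_at_most_def)
  qed auto
  have "vball G E v n \<subseteq> (\<Union>k\<le>n. (E ^^ k) `` {v})"
  proof
    fix g assume "g \<in> vball G E v n"
    then have g: "g \<in> G" "vdist G E v g \<le> real n" by (auto simp: vball_def)
    have "edge_count E v g \<le> n" using edge_count_le_vdist[OF G assms(4) g(1)] g(2) by linarith
    moreover have "(v, g) \<in> E ^^ edge_count E v g"
      using G assms(4) g by (intro edge_count_relpow) (auto simp: connected_graph_def)
    ultimately show "g \<in> (\<Union>k\<le>n. (E ^^ k) `` {v})" by auto
  qed
  then show ?thesis using fin by (auto intro: finite_subset)
qed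

text \<open>
  The edges are admissible paths for the visual metric, because the path metric restricted to an edge
  is the usual metric of an interval and the sums defining the length telescope.
\<close>

lemma arclength_path_edge:
  assumes "simple_graph G E" "connected_graph G E" "(u, w) \<in> E"
  shows "arclength_path G E (vert u) (vert w) 1 (edge_point u w)"
proof -
  have "curve_length (path_dist G E) (edge_point u w) a b = ereal (b - a)"
    if ab: "0 \<le> a" "a \<le> b" "b \<le> 1" for a b
  proof -
    have *: "(\<Sum>i<n. path_dist G E (edge_point u w (s i)) (edge_point u w (s (Suc i)))) = b - a"
      if s: "s 0 = a" "s n = b" "\<forall>i<n. s i \<le> s (Suc i)" for s and n :: nat
    proof -
      have mono: "s i \<le> s j" if "i \<le> j" "j \<le> n" for i j
        using that
      proof (induction j rule: dec_induct)
        case (step j)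
        then have "s i \<le> s j" "s j \<le> s (Suc j)" using s(3) by auto
        then show ?case by simp
      qed simp
      have "s i \<in> {0..1}" if "i \<le> n" for i
        using mono[of 0 i] mono[of i n] s ab that by auto
      then have "(\<Sum>i<n. path_dist G E (edge_point u w (s i)) (edge_point u w (s (Suc i))))
          = (\<Sum>i<n. s (Suc i) - s i)"
        using s(3) by (intro sum.cong HOL.refl) (auto simp: path_dist_edge[OF assms])
      also have "\<dots> = b - a" using sum_lessThan_telescope[of s n] s by simp
      finally show ?thesis .
    qed
    have "{ereal (\<Sum>i<n. path_dist G E (edge_point u w (s i)) (edge_point u w (s (Suc i)))) |
        (n::nat) s. s 0 = a \<and> s n = b \<and> (\<forall>i<n. s i \<le> s (Suc i))} = {ereal (b - a)}" (is "?A = _")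
    proof
      show "?A \<subseteq> {ereal (b - a)}" using * by auto
      have "ereal (b - a) = ereal (\<Sum>i<1. path_dist G E (edge_point u w (if i = 0 then a else b))
          (edge_point u w (if Suc i = 0 then a else b)))"
        using ab by (simp add: path_dist_edge[OF assms])
      then show "{ereal (b - a)} \<subseteq> ?A" using ab
        by (auto intro!: exI[of _ "1::nat"] exI[of _ "\<lambda>i. if i = 0 then a else b"])
    qed
    then show ?thesis by (simp add: curve_length_def)
  qed
  then show ?thesis using edge_point_in_metric_graph[OF assms(3)]
    by (auto simp: arclength_path_def vert_eq_edge_point[symmetric])
qed

text \<open>
  Along the edge the distance from \<open>v\<close> is at least \<open>vdist G E v u - 1\<close>; this accounts for the factor
  \<open>exp \<epsilon>\<close>.
\<close>

lemma visual_dist_edge: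
  assumes "simple_graph G E" "connected_graph G E" "(u, w) \<in> E" "v \<in> G" "\<epsilon> > 0"
  shows "visual_dist G E v \<epsilon> (vert u) (vert w) \<le> exp \<epsilon> * exp (- \<epsilon> * vdist G E v u)"
proof -
  let ?f = "\<lambda>c s. exp (- \<epsilon> * path_dist G E (vert v) (c s))"
  have nonneg: "0 \<le> integral {0..l} (?f c)" for l :: real and c :: "real \<Rightarrow> 'a point"
    by (cases "?f c integrable_on {0..l}") (auto intro: integral_nonneg simp: not_integrable_integral)
  have "visual_dist G E v \<epsilon> (vert u) (vert w) \<le> integral {0..1} (?f (edge_point u w))"
    unfolding visual_dist_def using arclength_path_edge[OF assms(1-3)] nonneg
    by (intro cInf_lower bdd_belowI[of _ 0]) auto
  also have "\<dots> \<le> exp \<epsilon> * exp (- \<epsilon> * vdist G E v u)"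
  proof (cases "?f (edge_point u w) integrable_on {0..1}")
    case True
    have "?f (edge_point u w) s \<le> exp \<epsilon> * exp (- \<epsilon> * vdist G E v u)" if "s \<in> {0..1}" for s
    proof -
      have "u \<in> G" using assms by (auto simp: simple_graph_def)
      have "path_dist G E (edge_point u w s) (edge_point u w 0) \<le> 1"
        using that by (subst path_dist_edge[OF assms(1-3)]) auto
      then have "vdist G E v u \<le> path_dist G E (vert v) (edge_point u w s) + 1"
        unfolding vdist_def
        using path_dist_triangle[OF assms(1,2) vert_in_metric_graph[OF assms(4)]
            edge_point_in_metric_graph[OF assms(3) that] vert_in_metric_graph[OF \<open>u \<in> G\<close>]]
        by (simp add: vert_eq_edge_point[symmetric])
      then have "- \<epsilon> * path_dist G E (vert v) (edge_point u w s) \<le> \<epsilon> + - \<epsilon> * vdist G E v u"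
        using assms(5) mult_left_mono[of "vdist G E v u" "path_dist G E (vert v) (edge_point u w s) + 1" \<epsilon>]
        by (simp add: algebra_simps)
      then show ?thesis by (simp flip: exp_add)
    qed
    then have "integral {0..1} (?f (edge_point u w)) \<le>
        integral {0..1::real} (\<lambda>_. exp \<epsilon> * exp (- \<epsilon> * vdist G E v u))"
      by (intro integral_le True) auto
    then show ?thesis by simp
  qed (simp add: not_integrable_integral)
  finally show ?thesis .
qed

section \<open>Energy and mass of minimisers\<close>

definition vertex_energy :: "('a \<times> 'a) set \<Rightarrow> (real \<Rightarrow> real) \<Rightarrow> ('a \<Rightarrow> real) \<Rightarrow> 'a \<Rightarrow> real" where
  "vertex_energy E V x g = 1 / 4 * (\<Sum>h\<in>E `` {g}. (x h - x g)\<^sup>2) + V (x g)"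

lemma action_on_eq:
  assumes "simple_graph G E" "connected_graph G E" "F \<subseteq> G"
  shows "action_on G E V F x = (\<Sum>g\<in>F. vertex_energy E V x g)"
  unfolding action_on_def vertex_energy_def grad_sq_def
  using assms by (intro sum.cong HOL.refl) (auto simp: vdist_eq_1[OF assms(1,2)] subset_iff)

text \<open>
  A localised form of \<open>global_minimiser\<close> that passes to smaller sets \<open>P\<close> and to pointwise limits.
\<close>

definition minimiser_on ::
    "'a set \<Rightarrow> ('a \<times> 'a) set \<Rightarrow> (real \<Rightarrow> real) \<Rightarrow> 'a set \<Rightarrow> ('a \<Rightarrow> real) \<Rightarrow> bool" where
  "minimiser_on G E V P x \<longleftrightarrow>
     (\<forall>y F. {g \<in> G. y g \<noteq> 0} \<subseteq> P \<longrightarrow> finite F \<longrightarrow> F \<subseteq> G \<longrightarrow> support_nhd G E y \<subseteq> F \<longrightarrow>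
        action_on G E V F (\<lambda>g. x g + y g) - action_on G E V F x \<ge> 0)"

lemma finite_nbrs:
  assumes "simple_graph G E" "degree_at_most S G E"
  shows "finite (E `` {g})" "card (E `` {g}) \<le> S"
proof -
  have "E `` {g} = {}" if "g \<notin> G" using that assms(1) by (auto simp: simple_graph_def)
  then show "finite (E `` {g})" "card (E `` {g}) \<le> S"
    using assms(2) by (cases "g \<in> G"; auto simp: degree_at_most_def)+
qed

lemma finite_Image_edges:
  assumes "simple_graph G E" "degree_at_most S G E" "finite A"
  shows "finite (E `` A)"
proof -
  have "E `` A = (\<Union>g\<in>A. E `` {g})" by auto
  then show ?thesis using finite_nbrs[OF assms(1,2)] assms(3) by simp
qed

text \<open>
  The competitor is \<open>a\<close> on \<open>A\<close> and \<open>x\<close> elsewhere. It has no excess energy inside \<open>A\<close>, and its energy on an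
  edge from \<open>A\<close> to a vertex \<open>g\<close> outside is a multiple of \<open>(x g - a)\<^sup>2\<close>. The second sum on the left keeps the energy of \<open>x\<close> on
  the edges that leave \<open>A\<close>, which is needed to see jumps across the boundary of \<open>A\<close>.
\<close>

lemma cutoff_inequality:
  assumes G: "simple_graph G E" "connected_graph G E" "degree_at_most S G E"
    and x: "minimiser_on G E V P x" and A: "finite A" "A \<subseteq> P" "P \<subseteq> G"
  shows "(\<Sum>g\<in>A. V (x g) - V a + 1 / 4 * (\<Sum>h\<in>E `` {g}. (x h - x g)\<^sup>2))
      + (\<Sum>g\<in>E `` A - A. 1 / 4 * (\<Sum>h\<in>E `` {g} \<inter> A. (x h - x g)\<^sup>2))
      \<le> real S / 2 * (\<Sum>g\<in>E `` A - A. (x g - a)\<^sup>2)"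
proof -
  define z where "z g = (if g \<in> A then a else x g)" for g
  let ?dA = "E `` A - A"
  have symE: "(g, h) \<in> E \<longleftrightarrow> (h, g) \<in> E" for g h using G(1) by (auto simp: simple_graph_def sym_def)
  note fin = finite_nbrs(1)[OF G(1,3)]
  have AG: "A \<subseteq> G" "E `` A \<subseteq> G" using A G(1) by (auto simp: simple_graph_def)
  have fA: "finite ?dA" using finite_Image_edges[OF G(1,3) A(1)] by auto
  have "support_nhd G E (\<lambda>g. z g - x g) \<subseteq> A \<union> E `` A"
  proof
    fix g assume "g \<in> support_nhd G E (\<lambda>g. z g - x g)"
    then obtain h where "g \<in> G" "h \<in> G" "z h - x h \<noteq> 0" "vdist G E g h \<le> 1"
      by (auto simp: support_nhd_def)
    then show "g \<in> A \<union> E `` A"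
      using vdist_le_1[OF G(1,2), of g h] symE by (auto simp: z_def split: if_splits)
  qed
  moreover have "{g \<in> G. z g - x g \<noteq> 0} \<subseteq> P" using A(2) by (auto simp: z_def)
  moreover have "finite (A \<union> E `` A)" "A \<union> E `` A \<subseteq> G"
    using AG A(1) finite_Image_edges[OF G(1,3) A(1)] by auto
  ultimately have "0 \<le> action_on G E V (A \<union> E `` A) (\<lambda>g. x g + (z g - x g)) - action_on G E V (A \<union> E `` A) x"
    using x[unfolded minimiser_on_def, rule_format, of "\<lambda>g. z g - x g" "A \<union> E `` A"] by simp
  also have "\<dots> = (\<Sum>g\<in>A \<union> ?dA. vertex_energy E V z g - vertex_energy E V x g)"
    using AG by (simp add: action_on_eq[OF G(1,2)] sum_subtractf Un_Diff_cancel)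
  also have "\<dots> = (\<Sum>g\<in>A. vertex_energy E V z g - vertex_energy E V x g)
      + (\<Sum>g\<in>?dA. vertex_energy E V z g - vertex_energy E V x g)"
    using A(1) fA by (intro sum.union_disjoint) auto
  also have "(\<Sum>g\<in>A. vertex_energy E V z g - vertex_energy E V x g) =
      (\<Sum>g\<in>A. 1 / 4 * (\<Sum>h\<in>E `` {g} - A. (x h - a)\<^sup>2)
        - (V (x g) - V a + 1 / 4 * (\<Sum>h\<in>E `` {g}. (x h - x g)\<^sup>2)))"
  proof (rule sum.cong[OF HOL.refl])
    fix g assume g: "g \<in> A"
    have "(\<Sum>h\<in>E `` {g}. (z h - z g)\<^sup>2) = (\<Sum>h\<in>E `` {g} - A. (x h - a)\<^sup>2)"
      using fin g by (intro sum.mono_neutral_cong_right) (auto simp: z_def)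
    then show "vertex_energy E V z g - vertex_energy E V x g =
      1 / 4 * (\<Sum>h\<in>E `` {g} - A. (x h - a)\<^sup>2)
        - (V (x g) - V a + 1 / 4 * (\<Sum>h\<in>E `` {g}. (x h - x g)\<^sup>2))"
      using g by (simp add: vertex_energy_def z_def)
  qed
  also have "(\<Sum>g\<in>?dA. vertex_energy E V z g - vertex_energy E V x g) =
      (\<Sum>g\<in>?dA. 1 / 4 * (\<Sum>h\<in>E `` {g} \<inter> A. (x g - a)\<^sup>2)
        - 1 / 4 * (\<Sum>h\<in>E `` {g} \<inter> A. (x h - x g)\<^sup>2))"
  proof (rule sum.cong[OF HOL.refl])
    fix g assume g: "g \<in> ?dA"
    have split: "(\<Sum>h\<in>E `` {g}. f h) = (\<Sum>h\<in>E `` {g} \<inter> A. f h) + (\<Sum>h\<in>E `` {g} - A. f h)" for f :: "'a \<Rightarrow> real"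
      using fin by (rule sum.Int_Diff)
    have "(\<Sum>h\<in>E `` {g} \<inter> A. (z h - z g)\<^sup>2) = (\<Sum>h\<in>E `` {g} \<inter> A. (x g - a)\<^sup>2)"
      using g by (intro sum.cong) (auto simp: z_def power2_commute)
    moreover have "(\<Sum>h\<in>E `` {g} - A. (z h - z g)\<^sup>2) = (\<Sum>h\<in>E `` {g} - A. (x h - x g)\<^sup>2)"
      using g by (intro sum.cong) (auto simp: z_def)
    ultimately have "(\<Sum>h\<in>E `` {g}. (z h - z g)\<^sup>2) - (\<Sum>h\<in>E `` {g}. (x h - x g)\<^sup>2) =
        (\<Sum>h\<in>E `` {g} \<inter> A. (x g - a)\<^sup>2) - (\<Sum>h\<in>E `` {g} \<inter> A. (x h - x g)\<^sup>2)"
      using split[of "\<lambda>h. (z h - z g)\<^sup>2"] split[of "\<lambda>h. (x h - x g)\<^sup>2"] by linarith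
    moreover have "z g = x g" using g by (simp add: z_def)
    ultimately show "vertex_energy E V z g - vertex_energy E V x g =
      1 / 4 * (\<Sum>h\<in>E `` {g} \<inter> A. (x g - a)\<^sup>2) - 1 / 4 * (\<Sum>h\<in>E `` {g} \<inter> A. (x h - x g)\<^sup>2)"
      unfolding vertex_energy_def by simp
  qed
  finally have *: "(\<Sum>g\<in>A. V (x g) - V a + 1 / 4 * (\<Sum>h\<in>E `` {g}. (x h - x g)\<^sup>2))
      + (\<Sum>g\<in>?dA. 1 / 4 * (\<Sum>h\<in>E `` {g} \<inter> A. (x h - x g)\<^sup>2))
      \<le> 1 / 4 * (\<Sum>g\<in>A. \<Sum>h\<in>E `` {g} - A. (x h - a)\<^sup>2)
        + 1 / 4 * (\<Sum>g\<in>?dA. \<Sum>h\<in>E `` {g} \<inter> A. (x g - a)\<^sup>2)"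
    by (simp add: sum_subtractf sum_distrib_left)
  \<comment> \<open>Each edge leaving \<open>A\<close> is counted once from either end; both counts give the same sum.\<close>
  have "(\<Sum>g\<in>A. \<Sum>h\<in>E `` {g} - A. (x h - a)\<^sup>2) =
      (\<Sum>g\<in>A. \<Sum>h\<in>{h \<in> ?dA. (g, h) \<in> E}. (x h - a)\<^sup>2)"
    by (intro sum.cong HOL.refl) auto
  also have "\<dots> = (\<Sum>h\<in>?dA. \<Sum>g\<in>{g \<in> A. (g, h) \<in> E}. (x h - a)\<^sup>2)"
    by (rule sum.swap_restrict[OF A(1) fA])
  also have "\<dots> = (\<Sum>g\<in>?dA. \<Sum>h\<in>E `` {g} \<inter> A. (x g - a)\<^sup>2)"
    using symE by (intro sum.cong HOL.refl) auto
  finally have "(\<Sum>g\<in>A. V (x g) - V a + 1 / 4 * (\<Sum>h\<in>E `` {g}. (x h - x g)\<^sup>2))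
      + (\<Sum>g\<in>?dA. 1 / 4 * (\<Sum>h\<in>E `` {g} \<inter> A. (x h - x g)\<^sup>2))
      \<le> 1 / 2 * (\<Sum>g\<in>?dA. \<Sum>h\<in>E `` {g} \<inter> A. (x g - a)\<^sup>2)"
    using * by simp
  also have "(\<Sum>g\<in>?dA. \<Sum>h\<in>E `` {g} \<inter> A. (x g - a)\<^sup>2) \<le> (\<Sum>g\<in>?dA. real S * (x g - a)\<^sup>2)"
  proof (intro sum_mono)
    fix g
    have "card (E `` {g} \<inter> A) \<le> S"
      using card_mono[OF fin, of "E `` {g} \<inter> A" g] finite_nbrs(2)[OF G(1,3), of g] by auto
    then show "(\<Sum>h\<in>E `` {g} \<inter> A. (x g - a)\<^sup>2) \<le> real S * (x g - a)\<^sup>2"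
      by (simp add: mult_right_mono)
  qed
  finally show ?thesis by (simp add: sum_distrib_left)
qed

text \<open>
  A vertex \<open>g\<close> of the outer boundary of \<open>B\<close> has a neighbour that deviates from \<open>a\<close> by more than \<open>H\<close>.
  Either \<open>g\<close> deviates by at most \<open>H / 2\<close>, and the edge carries energy, or \<open>g\<close> deviates by more than
  \<open>H / 2\<close>: then the potential at \<open>g\<close> is bounded below if \<open>g \<in> A\<close>, and \<open>g\<close> contributes to the sum on the
  right if \<open>g \<notin> A\<close>.
\<close>

lemma deviation_boundary_count:
  assumes G: "simple_graph G E" "connected_graph G E" "degree_at_most S G E"
    and x: "minimiser_on G E V P x" and A: "finite A" "A \<subseteq> P" "P \<subseteq> G"
    and "H > 0" "\<mu> > 0" and V: "\<And>g. V a \<le> V (x g)"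
    and well: "\<And>g. \<bar>x g - a\<bar> \<le> H \<Longrightarrow> \<mu> * (x g - a)\<^sup>2 \<le> V (x g) - V a"
    and B: "B = {g \<in> A. H < \<bar>x g - a\<bar>}" and m: "m = min (\<mu> * (H / 2)\<^sup>2) (1 / 4 * (H / 2)\<^sup>2)"
  shows "m * real (card (E `` B - B)) \<le> (real S / 2 + 1) * (\<Sum>g\<in>E `` A - A. (x g - a)\<^sup>2)"
proof -
  let ?dA = "E `` A - A" and ?dB = "E `` B - B"
  define p where "p g = V (x g) - V a + 1 / 4 * (\<Sum>h\<in>E `` {g}. (x h - x g)\<^sup>2)" for g
  define p' where "p' g = 1 / 4 * (\<Sum>h\<in>E `` {g} \<inter> A. (x h - x g)\<^sup>2) + (x g - a)\<^sup>2" for g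
  have symE: "(g, h) \<in> E \<longleftrightarrow> (h, g) \<in> E" for g h using G(1) by (auto simp: simple_graph_def sym_def)
  note fin = finite_nbrs(1)[OF G(1,3)]
  have fA: "finite ?dA" using finite_Image_edges[OF G(1,3) A(1)] by auto
  have BA: "B \<subseteq> A" using B by auto
  then have fB: "finite ?dB" using finite_Image_edges[OF G(1,3)] A(1) finite_subset by blast
  have p0: "0 \<le> p g" "0 \<le> p' g" for g using V[of g] by (auto simp: p_def p'_def sum_nonneg)
  have jump: "(H / 2)\<^sup>2 \<le> (x b - x g)\<^sup>2" if "b \<in> B" "\<bar>x g - a\<bar> \<le> H / 2" for b g
  proof -
    have "H < \<bar>x b - a\<bar>" using that(1) B by auto
    then have "\<bar>H / 2\<bar> \<le> \<bar>x b - x g\<bar>" using that(2) \<open>H > 0\<close> by arith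
    then show ?thesis by (simp only: abs_le_square_iff)
  qed
  have far: "(H / 2)\<^sup>2 \<le> (x g - a)\<^sup>2" if "\<not> \<bar>x g - a\<bar> \<le> H / 2" for g
    using that \<open>H > 0\<close> by (intro iffD1[OF abs_le_square_iff]) auto
  have pm: "m \<le> p g" if g: "g \<in> ?dB \<inter> A" for g
  proof -
    obtain b where b: "b \<in> B" "b \<in> E `` {g}" using g symE by auto
    have gH: "\<bar>x g - a\<bar> \<le> H" using g B by auto
    show ?thesis
    proof (cases "\<bar>x g - a\<bar> \<le> H / 2")
      case True
      have "(x b - x g)\<^sup>2 \<le> (\<Sum>h\<in>E `` {g}. (x h - x g)\<^sup>2)"
        using b fin by (intro member_le_sum) auto
      then show ?thesis using jump[OF b(1) True] V[of g] m by (auto simp: p_def min_def)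
    next
      case False
      have "\<mu> * (H / 2)\<^sup>2 \<le> \<mu> * (x g - a)\<^sup>2" using far[OF False] \<open>\<mu> > 0\<close> by simp
      also have "\<dots> \<le> V (x g) - V a" by (rule well[OF gH])
      also have "\<dots> \<le> p g" by (simp add: p_def sum_nonneg)
      finally show ?thesis using m by simp
    qed
  qed
  have pm': "m \<le> p' g" if g: "g \<in> ?dB \<inter> ?dA" for g
  proof -
    obtain b where b: "b \<in> B" "b \<in> E `` {g} \<inter> A" using g symE BA by auto
    show ?thesis
    proof (cases "\<bar>x g - a\<bar> \<le> H / 2")
      case True
      have "(x b - x g)\<^sup>2 \<le> (\<Sum>h\<in>E `` {g} \<inter> A. (x h - x g)\<^sup>2)"
        using b fin by (intro member_le_sum) auto
      then show ?thesis using jump[OF b(1) True] m by (auto simp: p'_def min_def intro: add_increasing2)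
    next
      case False
      have "1 / 4 * (H / 2)\<^sup>2 \<le> (x g - a)\<^sup>2" using far[OF False] zero_le_power2[of "H / 2"] by linarith
      also have "\<dots> \<le> p' g" by (simp add: p'_def sum_nonneg)
      finally show ?thesis using m by simp
    qed
  qed
  have "?dB = (?dB \<inter> A) \<union> (?dB \<inter> ?dA)" using BA by auto
  then have "card ?dB \<le> card (?dB \<inter> A) + card (?dB \<inter> ?dA)" by (metis card_Un_le)
  moreover have "0 < m" using m \<open>H > 0\<close> \<open>\<mu> > 0\<close> by simp
  ultimately have "m * real (card ?dB) \<le> m * real (card (?dB \<inter> A)) + m * real (card (?dB \<inter> ?dA))"
    by (simp flip: distrib_left of_nat_add)
  also have "m * real (card (?dB \<inter> A)) \<le> (\<Sum>g\<in>?dB \<inter> A. p g)"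
    using pm sum_bounded_below[of "?dB \<inter> A" m p] by (simp add: mult.commute)
  also have "\<dots> \<le> (\<Sum>g\<in>A. p g)" using A(1) p0 by (intro sum_mono2) auto
  also have "m * real (card (?dB \<inter> ?dA)) \<le> (\<Sum>g\<in>?dB \<inter> ?dA. p' g)"
    using pm' sum_bounded_below[of "?dB \<inter> ?dA" m p'] by (simp add: mult.commute)
  also have "\<dots> \<le> (\<Sum>g\<in>?dA. p' g)" using fA p0 by (intro sum_mono2) auto
  also have "(\<Sum>g\<in>A. p g) + (\<Sum>g\<in>?dA. p' g) \<le> (real S / 2 + 1) * (\<Sum>g\<in>?dA. (x g - a)\<^sup>2)"
    using cutoff_inequality[OF G x A, of a] by (simp add: p_def p'_def sum.distrib algebra_simps)
  finally show ?thesis by simp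
qed

text \<open>
  Where the deviation is at most \<open>H\<close>, the mass is bounded by the potential energy, which yields the
  linear term. The remaining vertices form the set \<open>B\<close> of the preceding lemma; the isoperimetric
  inequality turns the bound on its boundary into a bound on its size, with the exponent
  \<open>1 + 1 / (4 * D)\<close>, the reciprocal of \<open>4 * D / (4 * D + 1)\<close>.
\<close>

lemma mass_le_boundary_mass:
  assumes G: "simple_graph G E" "connected_graph G E" "degree_at_most S G E"
    and x: "minimiser_on G E V P x" and A: "finite A" "A \<subseteq> P" "P \<subseteq> G"
    and "H > 0" "\<mu> > 0" and V: "\<And>g. V a \<le> V (x g)"
    and well: "\<And>g. \<bar>x g - a\<bar> \<le> H \<Longrightarrow> \<mu> * (x g - a)\<^sup>2 \<le> V (x g) - V a"
    and bound: "\<And>g. \<bar>x g - a\<bar> \<le> 2 * H"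
    and "D > 0" "C > 0"
    and iso: "\<And>B. finite B \<Longrightarrow> B \<subseteq> G \<Longrightarrow>
        real (card B) powr (4 * D / (4 * D + 1)) \<le> C * real (card (outer_boundary G E B))"
    and m: "m = min (\<mu> * (H / 2)\<^sup>2) (1 / 4 * (H / 2)\<^sup>2)"
    and s: "s = (\<Sum>g\<in>E `` A - A. (x g - a)\<^sup>2)"
  shows "(\<Sum>g\<in>A. (x g - a)\<^sup>2) \<le> real S / (2 * \<mu>) * s
     + 4 * H\<^sup>2 * (C * ((real S / 2 + 1) / m)) powr (1 + 1 / (4 * D)) * s powr (1 + 1 / (4 * D))"
proof -
  define B where "B = {g \<in> A. H < \<bar>x g - a\<bar>}"
  define \<alpha> where "\<alpha> = 4 * D / (4 * D + 1)"
  have \<alpha>: "0 < \<alpha>" "1 + 1 / (4 * D) = inverse \<alpha>" using \<open>D > 0\<close> by (auto simp: \<alpha>_def field_simps)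
  have "0 < m" using m \<open>H > 0\<close> \<open>\<mu> > 0\<close> by simp
  have BA: "B \<subseteq> A" "finite B" "B \<subseteq> G" using A by (auto simp: B_def)
  have s0: "0 \<le> s" unfolding s by (intro sum_nonneg) auto
  have "card B powr \<alpha> \<le> C * real (card (E `` B - B))"
    using iso[OF BA(2,3)] outer_boundary_eq[OF G(1,2) BA(3)] by (simp add: \<alpha>_def)
  also have "\<dots> \<le> C * ((real S / 2 + 1) / m * s)"
    using deviation_boundary_count[OF G x A \<open>H > 0\<close> \<open>\<mu> > 0\<close> V well B_def m] \<open>0 < m\<close> \<open>C > 0\<close>
    by (intro mult_left_mono) (auto simp: s field_simps)
  finally have "(card B powr \<alpha>) powr inverse \<alpha> \<le> (C * ((real S / 2 + 1) / m) * s) powr inverse \<alpha>"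
    using \<alpha> by (intro powr_mono2) (auto simp: mult.assoc)
  then have cB: "card B \<le> (C * ((real S / 2 + 1) / m)) powr inverse \<alpha> * s powr inverse \<alpha>"
    using \<alpha>(1) s0 \<open>C > 0\<close> \<open>0 < m\<close> powr_mult[of "C * ((real S / 2 + 1) / m)" s "inverse \<alpha>"]
    by (simp add: powr_powr)
  have "\<mu> * (\<Sum>g\<in>A - B. (x g - a)\<^sup>2) \<le> (\<Sum>g\<in>A - B. V (x g) - V a)"
    unfolding sum_distrib_left by (intro sum_mono well) (auto simp: B_def)
  also have "\<dots> \<le> (\<Sum>g\<in>A. V (x g) - V a)" using A(1) V by (intro sum_mono2) auto
  also have "\<dots> \<le> (\<Sum>g\<in>A. V (x g) - V a + 1 / 4 * (\<Sum>h\<in>E `` {g}. (x h - x g)\<^sup>2))"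
    by (intro sum_mono) (simp add: sum_nonneg)
  also have "\<dots> \<le> real S / 2 * s"
  proof -
    have "0 \<le> (\<Sum>g\<in>E `` A - A. 1 / 4 * (\<Sum>h\<in>E `` {g} \<inter> A. (x h - x g)\<^sup>2))"
      by (intro sum_nonneg mult_nonneg_nonneg) auto
    then show ?thesis using cutoff_inequality[OF G x A, of a] unfolding s by linarith
  qed
  finally have "(\<Sum>g\<in>A - B. (x g - a)\<^sup>2) \<le> real S / (2 * \<mu>) * s"
    using \<open>\<mu> > 0\<close> by (simp add: field_simps)
  moreover have "(\<Sum>g\<in>B. (x g - a)\<^sup>2) \<le> 4 * H\<^sup>2 * real (card B)"
  proof -
    have "(x g - a)\<^sup>2 \<le> 4 * H\<^sup>2" for g
      using power_mono[OF bound[of g], of 2] by (simp add: power_mult_distrib)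
    then show ?thesis using sum_bounded_above[of B "\<lambda>g. (x g - a)\<^sup>2" "4 * H\<^sup>2"] by (simp add: mult.commute)
  qed
  moreover have "(\<Sum>g\<in>A. (x g - a)\<^sup>2) = (\<Sum>g\<in>A - B. (x g - a)\<^sup>2) + (\<Sum>g\<in>B. (x g - a)\<^sup>2)"
    using A(1) BA by (intro sum.subset_diff) auto
  moreover have "4 * H\<^sup>2 * real (card B) \<le> 4 * H\<^sup>2 * ((C * ((real S / 2 + 1) / m)) powr inverse \<alpha> * s powr inverse \<alpha>)"
    using cB by (intro mult_left_mono) auto
  ultimately show ?thesis unfolding \<alpha>(2) by (simp add: mult.assoc)
qed

section \<open>Growth of the mass with the radius\<close>

text \<open>
  With \<open>m\<close> the current mass, \<open>L * m powr - \<beta>\<close> is an upper bound for the length of the radius interval that is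
  left until blow-up. A step of length \<open>T * m powr - (\<alpha> / D)\<close> that increases the mass by
  \<open>(m / K) powr \<alpha> / 2\<close> is paid for by the decrease of this bound. The powers of \<open>m\<close> match because
  \<open>\<alpha> - \<beta> - 1 = - \<alpha> / D\<close>, which determines \<open>\<beta>\<close>.
\<close>

lemma powr_drop:
  fixes D K T :: real
  assumes "D > 0" "K \<ge> 1" "T > 0"
    and "\<alpha> = 4 * D / (4 * D + 1)" "\<beta> = 3 / (4 * D + 1)" "L = T * 2 powr (\<beta> + 2) * K powr \<alpha> / \<beta>"
    and m: "K \<le> m"
  shows "T * m powr (- (\<alpha> / D)) + L * (m + (m / K) powr \<alpha> / 2) powr (- \<beta>) \<le> L * m powr (- \<beta>)"
proof -
  define d where "d = (m / K) powr \<alpha> / 2"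
  have pos: "0 < \<beta>" "0 < \<alpha>" "\<alpha> < 1" "0 < m"
    using assms by auto
  moreover from this have "0 < L" "0 < d"
    using assms(2,3,6) by (auto simp: d_def)
  ultimately have pos: "0 < \<beta>" "0 < \<alpha>" "\<alpha> < 1" "0 < m" "0 < L" "0 < d" by auto
  have "(m / K) powr \<alpha> \<le> (m / K) powr 1" using pos assms by (intro powr_mono) auto
  also have "\<dots> \<le> m" using assms pos by (simp add: field_simps)
  finally have "d \<le> m" using pos by (simp add: d_def)
  have "\<exists>z>m. z < m + d \<and> (m + d) powr (- \<beta>) - m powr (- \<beta>) = (m + d - m) * (- \<beta> * z powr (- \<beta> - 1))"
    using pos by (intro MVT2) (auto intro!: derivative_eq_intros simp: field_simps)
  then obtain z where z: "m < z" "z < m + d"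
      "(m + d) powr (- \<beta>) - m powr (- \<beta>) = d * (- \<beta> * z powr (- \<beta> - 1))" by auto
  have "(2 * m) powr (- \<beta> - 1) \<le> z powr (- \<beta> - 1)"
    using z \<open>d \<le> m\<close> pos by (intro powr_mono2') auto
  then have "L * (d * (\<beta> * (2 * m) powr (- \<beta> - 1))) \<le> L * (d * (\<beta> * z powr (- \<beta> - 1)))"
    using pos by (intro mult_left_mono) auto
  also have "\<dots> = L * m powr (- \<beta>) - L * (m + d) powr (- \<beta>)"
  proof -
    have "d * (\<beta> * z powr (- \<beta> - 1)) = m powr (- \<beta>) - (m + d) powr (- \<beta>)"
      using z(3) by simp
    then show ?thesis by (simp only: right_diff_distrib)
  qed
  also have "L * (d * (\<beta> * (2 * m) powr (- \<beta> - 1))) = T * m powr (- (\<alpha> / D))"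
  proof -
    have e: "\<alpha> + (- \<beta> - 1) = - (\<alpha> / D)"
    proof -
      define e where "e = 1 / (4 * D + 1)"
      have "\<alpha> = 4 * (D * e)" "\<beta> = 3 * e" "\<alpha> / D = 4 * e" using assms(1,4,5) by (auto simp: e_def)
      moreover have "4 * (D * e) + e = 1" using assms(1) by (simp add: e_def field_simps)
      ultimately show ?thesis by linarith
    qed
    have two: "2 powr (\<beta> + 2) * 2 powr (- \<beta> - 1) = (2::real)"
      by (simp flip: powr_add)
    have "L * (d * (\<beta> * (2 * m) powr (- \<beta> - 1))) =
        T * (2 powr (\<beta> + 2) * 2 powr (- \<beta> - 1)) * (m powr \<alpha> * m powr (- \<beta> - 1)) / 2"
    proof -
      have "(2 * m) powr (- \<beta> - 1) = 2 powr (- \<beta> - 1) * m powr (- \<beta> - 1)"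
        using pos by (simp add: powr_mult)
      moreover have "K powr \<alpha> * (m / K) powr \<alpha> = m powr \<alpha>"
        using pos assms(2) by (simp add: powr_divide)
      moreover have "L * \<beta> = T * 2 powr (\<beta> + 2) * K powr \<alpha>" using pos(1) unfolding assms(6) by simp
      ultimately show ?thesis unfolding d_def by algebra
    qed
    also have "\<dots> = T * m powr (- (\<alpha> / D))" unfolding two by (simp flip: powr_add e)
    finally show ?thesis .
  qed
  finally show ?thesis by (simp add: d_def)
qed

text \<open>
  Here \<open>q\<close> stands for the squared deviation of a minimiser, \<open>u\<close> for the visual distance from the boundary
  point, \<open>w g\<close> for a bound on the visual length of the edges at \<open>g\<close>, and \<open>Sh t\<close> for the vertices just
  outside the ball of radius \<open>t\<close>. The radius \<open>r\<close> is uniform in \<open>P\<close> and \<open>q\<close>. The mass grows in two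
  regimes: from \<open>\<kappa>\<close> to the threshold \<open>m\<^sub>0\<close> by additive steps \<open>\<sigma>\<close>, for which it suffices that the shells
  become arbitrarily thin, and from \<open>m\<^sub>0\<close> on by the superlinear growth that leads to blow-up.
\<close>

lemma mass_decay_radius:
  fixes u w :: "'a \<Rightarrow> real" and Sh :: "real \<Rightarrow> 'a set"
  assumes D: "D > 0" and K: "K\<^sub>1 > 0" "K\<^sub>2 > 0" and "Q\<^sub>0 > 0" "N > 0" "R > 0" "\<kappa> > 0"
    and count: "\<And>\<tau>. \<tau> > 0 \<Longrightarrow> finite {g \<in> G. \<tau> \<le> w g} \<and> real (card {g \<in> G. \<tau> \<le> w g}) \<le> N * \<tau> powr (- D)"
    and shell: "\<And>r g. g \<in> Sh r \<Longrightarrow> g \<in> G \<and> r \<le> u g \<and> u g \<le> r + w g"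
    and thin: "\<And>\<tau>. \<tau> > 0 \<Longrightarrow> \<exists>r'>0. \<forall>r g. r \<le> r' \<longrightarrow> g \<in> Sh r \<longrightarrow> w g < \<tau>"
  shows "\<exists>r>0. \<forall>P q. finite P \<longrightarrow> P \<subseteq> G \<longrightarrow> (\<forall>g. 0 \<le> q g \<and> q g \<le> Q\<^sub>0) \<longrightarrow>
     (\<forall>t. 0 < t \<and> t < R \<longrightarrow> (\<Sum>g | g \<in> P \<and> u g < t. q g) \<le>
        K\<^sub>1 * (\<Sum>g\<in>P \<inter> Sh t. q g) + K\<^sub>2 * (\<Sum>g\<in>P \<inter> Sh t. q g) powr (1 + 1 / (4 * D))) \<longrightarrow>
     (\<Sum>g | g \<in> P \<and> u g < r. q g) < \<kappa>"
proof -
  define M where "M P q t = (\<Sum>g | g \<in> P \<and> u g < t. q g)" for P and q :: "'a \<Rightarrow> real" and t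
  define s where "s P q t = (\<Sum>g\<in>P \<inter> Sh t. q g)" for P and q :: "'a \<Rightarrow> real" and t
  define ok where "ok P q \<longleftrightarrow> finite P \<and> P \<subseteq> G \<and> (\<forall>g. 0 \<le> q g \<and> q g \<le> Q\<^sub>0) \<and>
     (\<forall>t. 0 < t \<and> t < R \<longrightarrow> M P q t \<le> K\<^sub>1 * s P q t + K\<^sub>2 * s P q t powr (1 + 1 / (4 * D)))"
    for P and q :: "'a \<Rightarrow> real"
  define K where "K = K\<^sub>1 + K\<^sub>2 + 1"
  define \<alpha> where "\<alpha> = 4 * D / (4 * D + 1)"
  define \<beta> where "\<beta> = 3 / (4 * D + 1)"
  define T where "T = (2 * Q\<^sub>0 * N * K powr \<alpha>) powr (1 / D)"
  define L where "L = T * 2 powr (\<beta> + 2) * K powr \<alpha> / \<beta>"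
  define f where "f m = L * m powr (- \<beta>)" for m
  define \<sigma> where "\<sigma> = min 1 (\<kappa> / K)"
  have pos: "0 < K" "1 \<le> K" "0 < \<alpha>" "0 < \<beta>" "0 < T" "0 < L" "0 < \<sigma>"
    using assms by (auto simp: K_def \<alpha>_def \<beta>_def T_def L_def \<sigma>_def)
  have \<alpha>: "1 + 1 / (4 * D) = inverse \<alpha>" "\<alpha> \<le> 1" using D by (auto simp: \<alpha>_def field_simps)
  have s0: "0 \<le> s P q t" if "ok P q" for P q t
    unfolding s_def using that by (intro sum_nonneg) (auto simp: ok_def)
  have s_large: "(M P q t / K) powr \<alpha> \<le> s P q t" if ok: "ok P q" and t: "0 < t" "t < R" and M: "K \<le> M P q t" for P q t
  proof -
    have le: "M P q t \<le> K\<^sub>1 * s P q t + K\<^sub>2 * s P q t powr inverse \<alpha>"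
      using ok t \<alpha> by (auto simp: ok_def)
    have s1: "1 \<le> s P q t"
    proof (rule ccontr)
      assume "\<not> 1 \<le> s P q t"
      then have "s P q t \<le> 1" "s P q t powr inverse \<alpha> \<le> 1 powr inverse \<alpha>"
        using s0[OF ok, of t] pos powr_mono2[of "inverse \<alpha>" "s P q t" 1] by auto
      then have "K\<^sub>1 * s P q t \<le> K\<^sub>1 * 1" "K\<^sub>2 * s P q t powr inverse \<alpha> \<le> K\<^sub>2 * 1"
        using K by (auto intro: mult_left_mono)
      then show False using le M by (simp add: K_def)
    qed
    then have "s P q t powr 1 \<le> s P q t powr inverse \<alpha>"
      using pos \<alpha> by (intro powr_mono) (auto simp: field_simps)
    then have "K\<^sub>1 * s P q t \<le> K\<^sub>1 * s P q t powr inverse \<alpha>" using K s1 by simp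
    then have "M P q t \<le> K * s P q t powr inverse \<alpha>"
      unfolding K_def distrib_right
      using le powr_ge_zero[of "s P q t" "inverse \<alpha>"] by linarith
    then have "M P q t / K \<le> s P q t powr inverse \<alpha>" using pos by (simp add: field_simps)
    then have "(M P q t / K) powr \<alpha> \<le> (s P q t powr inverse \<alpha>) powr \<alpha>"
      using pos M by (intro powr_mono2) auto
    then show ?thesis using pos s1 by (simp add: powr_powr)
  qed
  have s_small: "\<sigma> \<le> s P q t" if ok: "ok P q" and t: "0 < t" "t < R" and M: "\<kappa> \<le> M P q t" for P q t
  proof (rule ccontr)
    assume "\<not> \<sigma> \<le> s P q t"
    then have s1: "s P q t < 1" "s P q t < \<kappa> / K" by (auto simp: \<sigma>_def)
    have le: "M P q t \<le> K\<^sub>1 * s P q t + K\<^sub>2 * s P q t powr inverse \<alpha>"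
      using ok t \<alpha> by (auto simp: ok_def)
    have "s P q t powr inverse \<alpha> \<le> s P q t"
    proof (cases "s P q t = 0")
      case False
      then have "s P q t powr inverse \<alpha> \<le> s P q t powr 1"
        using s0[OF ok, of t] s1 pos \<alpha> by (intro powr_mono') (auto simp: field_simps)
      then show ?thesis using s0[OF ok, of t] by simp
    qed simp
    then have "K\<^sub>2 * s P q t powr inverse \<alpha> \<le> K\<^sub>2 * s P q t" using K by simp
    then have "M P q t \<le> K * s P q t" 
      unfolding K_def distrib_right using le s0[OF ok, of t] by linarith
    also have "\<dots> < \<kappa>" using s1 pos by (simp add: field_simps)
    finally show False using M by simp
  qed
  have grow: "M P q t + s P q t \<le> M P q (t + \<tau>) + (\<Sum>g\<in>P \<inter> Sh t \<inter> {g. \<tau> \<le> w g}. q g)"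
    if ok: "ok P q" and "\<tau> > 0" for P q t \<tau>
  proof -
    have fP: "finite P" and q: "\<And>g. 0 \<le> q g" using ok by (auto simp: ok_def)
    have "s P q t = (\<Sum>g\<in>P \<inter> Sh t \<inter> {g. \<tau> \<le> w g}. q g) + (\<Sum>g\<in>P \<inter> Sh t - {g. \<tau> \<le> w g}. q g)"
      unfolding s_def using fP by (simp add: sum.Int_Diff)
    moreover have "M P q t + (\<Sum>g\<in>P \<inter> Sh t - {g. \<tau> \<le> w g}. q g)
        = (\<Sum>g\<in>{g. g \<in> P \<and> u g < t} \<union> (P \<inter> Sh t - {g. \<tau> \<le> w g}). q g)"
      unfolding M_def using fP shell by (intro sum.union_disjoint[symmetric]) force+
    moreover have "\<dots> \<le> M P q (t + \<tau>)"
      unfolding M_def using fP shell q \<open>\<tau> > 0\<close> by (intro sum_mono2) force+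
    ultimately show ?thesis by linarith
  qed
  \<comment> \<open>\<open>Z\<close> consists of the radii from which blow-up is due before \<open>R\<close>. One more step leads from any of
    them to another one with larger mass, whereas the mass has only finitely many values.\<close>
  have blowup: False if ok: "ok P q" and t: "0 < t" "K \<le> M P q t" "t + f (M P q t) < R" for P q t
  proof -
    define Z where "Z = {t. 0 < t \<and> K \<le> M P q t \<and> t + f (M P q t) < R}"
    have fP: "finite P" "P \<subseteq> G" and q: "\<And>g. 0 \<le> q g" "\<And>g. q g \<le> Q\<^sub>0" using ok by (auto simp: ok_def)
    have "M P q ` Z \<subseteq> (\<lambda>A. \<Sum>g\<in>A. q g) ` Pow P" by (auto simp: M_def)
    then have finZ: "finite (M P q ` Z)" using fP finite_subset by blast
    moreover have "Z \<noteq> {}" using t by (auto simp: Z_def)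
    ultimately have "Max (M P q ` Z) \<in> M P q ` Z" by (intro Max_in) auto
    then obtain t where t: "t \<in> Z" "M P q t = Max (M P q ` Z)" by auto
    define m where "m = M P q t"
    define d where "d = (m / K) powr \<alpha> / 2"
    define \<tau> where "\<tau> = T * m powr (- (\<alpha> / D))"
    have m: "K \<le> m" "0 < t" "t + f m < R" using t by (auto simp: Z_def m_def)
    then have "0 < m" "0 < f m" using pos by (auto simp: f_def)
    then have "t < R" "0 < d" "0 < \<tau>" using m pos by (auto simp: d_def \<tau>_def)
    \<comment> \<open>The thickness \<open>\<tau>\<close> is such that vertices with \<open>w\<close> at least \<open>\<tau>\<close> carry at most half of the mass
      of the shell; the other vertices of the shell lie in the ball of radius \<open>t + \<tau>\<close>.\<close>
    have "Q\<^sub>0 * (N * \<tau> powr (- D)) = d"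
    proof -
      have "\<tau> powr (- D) = (T powr - D) * m powr \<alpha>"
        using D pos \<open>0 < m\<close> unfolding \<tau>_def by (simp add: powr_mult powr_powr)
      also have "T powr - D = inverse (2 * Q\<^sub>0 * N * K powr \<alpha>)"
        unfolding T_def using D assms(4,5) pos by (simp add: powr_powr powr_minus)
      finally show ?thesis using assms(4,5) pos \<open>0 < m\<close> by (simp add: d_def powr_divide field_simps)
    qed
    moreover have "(\<Sum>g\<in>P \<inter> Sh t \<inter> {g. \<tau> \<le> w g}. q g) \<le> Q\<^sub>0 * (N * \<tau> powr (- D))"
    proof -
      have "(\<Sum>g\<in>P \<inter> Sh t \<inter> {g. \<tau> \<le> w g}. q g) \<le> real (card (P \<inter> Sh t \<inter> {g. \<tau> \<le> w g})) * Q\<^sub>0"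
        using q by (intro sum_bounded_above) auto
      also have "card (P \<inter> Sh t \<inter> {g. \<tau> \<le> w g}) \<le> card {g \<in> G. \<tau> \<le> w g}"
        using count[OF \<open>0 < \<tau>\<close>] fP by (intro card_mono) auto
      then have "real (card (P \<inter> Sh t \<inter> {g. \<tau> \<le> w g})) * Q\<^sub>0 \<le> (N * \<tau> powr (- D)) * Q\<^sub>0"
        using count[OF \<open>0 < \<tau>\<close>] \<open>Q\<^sub>0 > 0\<close> by (intro mult_right_mono) linarith+
      finally show ?thesis by (simp add: mult.commute)
    qed
    moreover have "2 * d \<le> s P q t"
      using s_large[OF ok m(2) \<open>t < R\<close>] m(1) by (simp add: d_def m_def)
    ultimately have md: "m + d \<le> M P q (t + \<tau>)"
      using grow[OF ok \<open>0 < \<tau>\<close>, of t] by (simp add: m_def)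
    have "f (M P q (t + \<tau>)) \<le> f (m + d)"
      unfolding f_def using md pos \<open>0 < m\<close> \<open>0 < d\<close> by (intro mult_left_mono powr_mono2') auto
    moreover have "\<tau> + f (m + d) \<le> f m"
      using powr_drop[OF D pos(2,5) \<alpha>_def \<beta>_def L_def m(1)] by (simp add: \<tau>_def f_def d_def)
    ultimately have "t + \<tau> \<in> Z" using m md \<open>0 < d\<close> \<open>0 < \<tau>\<close> by (auto simp: Z_def)
    then have "M P q (t + \<tau>) \<le> m" using finZ t(2) by (auto simp: m_def)
    then show False using md \<open>0 < d\<close> by simp
  qed
  have small: "\<exists>r>0. r \<le> R / 2 \<and> (\<forall>P q. ok P q \<longrightarrow> \<kappa> \<le> M P q r \<longrightarrow> M P q r + real k * \<sigma> \<le> M P q (R / 2))" for k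
  proof (induction k)
    case 0
    show ?case using \<open>R > 0\<close> by (intro exI[of _ "R / 2"]) auto
  next
    case (Suc k)
    then obtain r where r: "0 < r" "r \<le> R / 2"
      "\<And>P q. ok P q \<Longrightarrow> \<kappa> \<le> M P q r \<Longrightarrow> M P q r + real k * \<sigma> \<le> M P q (R / 2)" by blast
    obtain r' where r': "0 < r'" "\<And>t g. t \<le> r' \<Longrightarrow> g \<in> Sh t \<Longrightarrow> w g < r / 2"
      using thin[of "r / 2"] r(1) by auto
    \<comment> \<open>All vertices of the shell at this radius lie in the ball of radius \<open>r\<close>.\<close>
    define t where "t = min r' (r / 2)"
    have t: "0 < t" "t \<le> r'" "t \<le> r / 2" "t < R" using r r' \<open>R > 0\<close> by (auto simp: t_def min_def)
    have "M P q t + real (Suc k) * \<sigma> \<le> M P q (R / 2)" if ok: "ok P q" and M: "\<kappa> \<le> M P q t" for P q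
    proof -
      have "P \<inter> Sh t \<inter> {g. r / 2 \<le> w g} = {}" using r'(2)[OF t(2)] by fastforce
      then have "M P q t + \<sigma> \<le> M P q (t + r / 2)"
        using grow[OF ok, of "r / 2" t] s_small[OF ok t(1,4) M] r(1) by simp
      also have "\<dots> \<le> M P q r"
        using ok t(3) unfolding M_def by (intro sum_mono2) (auto simp: ok_def)
      finally have "M P q t + \<sigma> \<le> M P q r" .
      moreover then have "\<kappa> \<le> M P q r" using M pos by linarith
      ultimately show ?thesis using r(3)[OF ok] by (fastforce simp: algebra_simps)
    qed
    then show ?case using t r by (intro exI[of _ t]) auto
  qed
  define m\<^sub>0 where "m\<^sub>0 = max K ((R / (4 * L)) powr (- (1 / \<beta>)))"
  have m0: "K \<le> m\<^sub>0" "0 < m\<^sub>0" using pos by (auto simp: m\<^sub>0_def)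
  have fm0: "f m\<^sub>0 < R / 2"
  proof -
    have "m\<^sub>0 powr (- \<beta>) \<le> ((R / (4 * L)) powr (- (1 / \<beta>))) powr (- \<beta>)"
      using pos \<open>R > 0\<close> by (intro powr_mono2') (auto simp: m\<^sub>0_def)
    also have "\<dots> = R / (4 * L)" using pos \<open>R > 0\<close> by (simp add: powr_powr)
    finally have "L * m\<^sub>0 powr (- \<beta>) \<le> L * (R / (4 * L))" using pos by (intro mult_left_mono) auto
    also have "\<dots> < R / 2" using pos \<open>R > 0\<close> by simp
    finally show ?thesis by (simp add: f_def)
  qed
  obtain k where k: "m\<^sub>0 \<le> real k * \<sigma>"
    using reals_Archimedean3[OF pos(7), rule_format, of m\<^sub>0] less_imp_le by blast
  obtain r where r: "0 < r" "\<And>P q. ok P q \<Longrightarrow> \<kappa> \<le> M P q r \<Longrightarrow> M P q r + real k * \<sigma> \<le> M P q (R / 2)"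
    using small[of k] by blast
  have "M P q r < \<kappa>" if ok: "ok P q" for P q
  proof (rule ccontr)
    assume "\<not> M P q r < \<kappa>"
    then have M: "m\<^sub>0 \<le> M P q (R / 2)" using r(2)[OF ok] k \<open>\<kappa> > 0\<close> by fastforce
    have "f (M P q (R / 2)) \<le> f m\<^sub>0"
      unfolding f_def using M m0 pos by (intro mult_left_mono powr_mono2') auto
    then show False using blowup[OF ok, of "R / 2"] M m0 fm0 \<open>R > 0\<close> by simp
  qed
  then show ?thesis using r(1) unfolding ok_def M_def s_def by blast
qed

section \<open>Decay of minimisers near a boundary point\<close>

text \<open>
  The quotient of \<open>V s - V c\<close> by \<open>(s - c)\<^sup>2\<close> extends continuously by \<open>V'' (c) / 2\<close>, by l'Hospital's rule.
  This value is nonnegative as a limit and nonzero by assumption, so the minimum of the quotient over the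
  interval is positive.
\<close>

lemma well_quadratic_growth:
  assumes "C2 V" and c: "global_min_point V c" "deriv (deriv V) c \<noteq> 0"
    and "c \<in> {l..r}" and unique: "\<And>s. s \<in> {l..r} \<Longrightarrow> global_min_point V s \<Longrightarrow> s = c"
  shows "\<exists>\<mu>>0. \<forall>s\<in>{l..r}. \<mu> * (s - c)\<^sup>2 \<le> V s - V c"
proof -
  have dV: "(V has_field_derivative deriv V s) (at s)" for s
    using assms(1) by (simp add: C2_def DERIV_deriv_iff_real_differentiable)
  have ddV: "(deriv V has_field_derivative deriv (deriv V) s) (at s)" for s
    using assms(1) by (simp add: C2_def DERIV_deriv_iff_real_differentiable)
  have V0: "deriv V c = 0"
    using DERIV_local_min[OF dV, of 1 c] c(1) by (auto simp: global_min_point_def)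
  define \<phi> where "\<phi> s = (if s = c then deriv (deriv V) c / 2 else (V s - V c) / (s - c)\<^sup>2)" for s
  have "((\<lambda>s. (deriv V s - deriv V c) / (s - c)) \<longlongrightarrow> deriv (deriv V) c) (at c)"
    using ddV[of c] by (simp add: has_field_derivative_iff)
  then have lim': "((\<lambda>s. deriv V s / (2 * (s - c))) \<longlongrightarrow> deriv (deriv V) c / 2) (at c)"
    unfolding V0 by (auto dest: tendsto_divide[OF _ tendsto_const, of _ _ _ 2] simp: mult.commute)
  have lim: "((\<lambda>s. (V s - V c) / (s - c)\<^sup>2) \<longlongrightarrow> deriv (deriv V) c / 2) (at c)"
  proof (rule lhopital[OF _ _ _ _ _ _ lim'])
    have "isCont V c" using dV DERIV_isCont by blast
    then show "((\<lambda>s. V s - V c) \<longlongrightarrow> 0) (at c)"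
      using LIM_zero isContD by blast
    show "((\<lambda>s. (s - c)\<^sup>2) \<longlongrightarrow> 0) (at c)" by (auto intro!: tendsto_eq_intros)
    show "\<forall>\<^sub>F s in at c. (s - c)\<^sup>2 \<noteq> 0" "\<forall>\<^sub>F s in at c. 2 * (s - c) \<noteq> 0"
      by (auto simp: eventually_at_filter)
    show "\<forall>\<^sub>F s in at c. ((\<lambda>s. V s - V c) has_field_derivative deriv V s) (at s)"
      using dV by (auto intro!: derivative_eq_intros always_eventually)
    show "\<forall>\<^sub>F s in at c. ((\<lambda>s. (s - c)\<^sup>2) has_field_derivative 2 * (s - c)) (at s)"
      by (auto intro!: derivative_eq_intros always_eventually)
  qed
  have "continuous (at s) \<phi>" for s
  proof (cases "s = c")
    case True
    have "(\<phi> \<longlongrightarrow> deriv (deriv V) c / 2) (at c)"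
      using lim by (rule Lim_transform_eventually) (auto simp: \<phi>_def eventually_at_filter)
    then show ?thesis using True by (simp add: isCont_def \<phi>_def)
  next
    case False
    have "isCont V s" using dV DERIV_isCont by blast
    then have "isCont (\<lambda>s. (V s - V c) / (s - c)\<^sup>2) s" using False by (intro continuous_intros) auto
    moreover have "\<forall>\<^sub>F t in nhds s. \<phi> t = (V t - V c) / (t - c)\<^sup>2"
      using t1_space_nhds[OF False] by (rule eventually_mono) (auto simp: \<phi>_def)
    ultimately show ?thesis by (subst isCont_cong)
  qed
  then have "continuous_on {l..r} \<phi>" by (simp add: continuous_at_imp_continuous_on)
  then obtain s\<^sub>0 where s0: "s\<^sub>0 \<in> {l..r}" "\<And>s. s \<in> {l..r} \<Longrightarrow> \<phi> s\<^sub>0 \<le> \<phi> s"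
    using continuous_attains_inf[of "{l..r}" \<phi>] assms(4) by auto
  have "0 < \<phi> s\<^sub>0"
  proof (cases "s\<^sub>0 = c")
    case True
    have "0 \<le> deriv (deriv V) c / 2"
      using c(1) by (intro tendsto_lowerbound[OF lim]) (auto simp: global_min_point_def)
    then show ?thesis using True c(2) by (simp add: \<phi>_def)
  next
    case False
    then have "V c < V s\<^sub>0"
      using unique[OF s0(1)] c(1) unfolding global_min_point_def by (meson not_le order_trans)
    then show ?thesis using False by (simp add: \<phi>_def)
  qed
  moreover have "\<phi> s\<^sub>0 * (s - c)\<^sup>2 \<le> V s - V c" if "s \<in> {l..r}" for s
    using s0(2)[OF that] by (cases "s = c") (auto simp: \<phi>_def field_simps split: if_splits)
  ultimately show ?thesis by blast
qed

text \<open>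
  The weight is at least \<open>\<tau>\<close> exactly on the ball of radius \<open>1 - ln \<tau> / \<epsilon>\<close> about \<open>v\<close>; rounding the
  radius up to an integer costs at most 1, whence the constant \<open>exp (2 * \<epsilon> * D)\<close>.
\<close>

lemma visual_weight_count:
  assumes G: "simple_graph G E" "connected_graph G E" "degree_at_most S G E" "v \<in> G"
    and "\<epsilon> > 0" "D > 0" "C > 0"
    and growth: "\<forall>n. real (card (vball G E v n)) \<le> C * exp (\<epsilon> * real n * D)"
    and "\<tau> > 0"
  shows "finite {g \<in> G. \<tau> \<le> exp \<epsilon> * exp (- \<epsilon> * vdist G E v g)} \<and>
    real (card {g \<in> G. \<tau> \<le> exp \<epsilon> * exp (- \<epsilon> * vdist G E v g)}) \<le> C * exp (2 * \<epsilon> * D) * \<tau> powr (- D)"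
    (is "finite ?A \<and> _")
proof -
  define y where "y = 1 - ln \<tau> / \<epsilon>"
  define n where "n = nat \<lceil>y\<rceil>"
  have le_y: "vdist G E v g \<le> y" if "g \<in> ?A" for g
  proof -
    have "ln \<tau> \<le> \<epsilon> - \<epsilon> * vdist G E v g"
      using that \<open>\<tau> > 0\<close> by (simp add: ln_le_cancel_iff[symmetric] ln_mult del: ln_le_cancel_iff)
    then show ?thesis using \<open>\<epsilon> > 0\<close> by (simp add: y_def field_simps)
  qed
  have sub: "?A \<subseteq> vball G E v n"
    using le_y real_nat_ceiling_ge[of y] by (force simp: vball_def n_def)
  then have fin: "finite ?A" "card ?A \<le> card (vball G E v n)"
    using finite_vball[OF G] finite_subset card_mono by blast+
  have "real (card ?A) \<le> C * exp (2 * \<epsilon> * D) * \<tau> powr (- D)"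
  proof (cases "?A = {}")
    case False
    then obtain g where g: "g \<in> ?A" by blast
    have "0 \<le> y" using le_y[OF g] edge_count_le_vdist[OF G(1,2,4), of g] g
      by (smt (verit) mem_Collect_eq of_nat_0_le_iff)
    then have "real n \<le> y + 1" by (simp add: n_def)
    then have "\<epsilon> * real n * D \<le> \<epsilon> * (y + 1) * D"
      using \<open>\<epsilon> > 0\<close> \<open>D > 0\<close> by (intro mult_right_mono mult_left_mono) auto
    also have "\<dots> = 2 * \<epsilon> * D + (- D) * ln \<tau>"
      using \<open>\<epsilon> > 0\<close> by (simp add: y_def field_simps)
    finally have "C * exp (\<epsilon> * real n * D) \<le> C * (exp (2 * \<epsilon> * D) * \<tau> powr (- D))"
      using \<open>C > 0\<close> \<open>\<tau> > 0\<close> by (simp add: powr_def flip: exp_add)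
    then show ?thesis using fin(2) growth[rule_format, of n] by (simp add: mult.assoc) 
  next
    case True
    then have "card ?A = 0" by (simp only: card.empty)
    then show ?thesis using \<open>C > 0\<close> by simp
  qed
  then show ?thesis using fin by blast
qed

text \<open>
  The set \<open>I\<close> contains the values of the minimisers, and in the application it is the interval between
  the two wells, of length \<open>2 * H\<close>. A value is either within \<open>H\<close> of the minimum \<open>a\<close>, where the potential grows quadratically, or counted
  as a vertex of the deviation set.
\<close>

lemma minimiser_decay_radius:
  fixes V :: "real \<Rightarrow> real"
  assumes G: "simple_graph G E" "connected_graph G E" "degree_at_most S G E" and v: "v \<in> G"
    and pos: "\<epsilon> > 0" "D > 0" "C\<^sub>D > 0" "C\<^sub>0 > 0"
    and growth: "\<forall>n. real (card (vball G E v n)) \<le> C\<^sub>D * exp (\<epsilon> * real n * D)"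
    and iso: "\<And>B. finite B \<Longrightarrow> B \<subseteq> G \<Longrightarrow>
        real (card B) powr (4 * D / (4 * D + 1)) \<le> C\<^sub>0 * real (card (outer_boundary G E B))"
    and "H > 0" "\<mu> > 0" and V: "\<And>s. s \<in> I \<Longrightarrow> V a \<le> V s"
    and well: "\<And>s. s \<in> I \<Longrightarrow> \<bar>s - a\<bar> \<le> H \<Longrightarrow> \<mu> * (s - a)\<^sup>2 \<le> V s - V a"
    and I: "\<And>s. s \<in> I \<Longrightarrow> \<bar>s - a\<bar> \<le> 2 * H"
    and u: "\<And>g. g \<in> G \<Longrightarrow> 0 < u g"
      "\<And>g h. (g, h) \<in> E \<Longrightarrow> \<bar>u g - u h\<bar> \<le> exp \<epsilon> * exp (- \<epsilon> * vdist G E v g)"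
    and "r\<^sub>0 > 0" "\<kappa> > 0"
  shows "\<exists>r>0. \<forall>P x. finite P \<longrightarrow> P \<subseteq> G \<longrightarrow> minimiser_on G E V P x \<longrightarrow> (\<forall>g. x g \<in> I) \<longrightarrow>
     (\<forall>g\<in>G - P. u g < r\<^sub>0 \<longrightarrow> x g = a) \<longrightarrow> (\<forall>g\<in>G. u g < r \<longrightarrow> \<bar>x g - a\<bar> \<le> \<kappa>)"
proof -
  define w where "w g = exp \<epsilon> * exp (- \<epsilon> * vdist G E v g)" for g
  define Sh where "Sh t = {h \<in> G. t \<le> u h \<and> (\<exists>g. (g, h) \<in> E \<and> u g < t)}" for t
  have symE: "(g, h) \<in> E \<longleftrightarrow> (h, g) \<in> E" for g h using G(1) by (auto simp: simple_graph_def sym_def)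
  have inG: "g \<in> G \<and> h \<in> G" if "(g, h) \<in> E" for g h using G(1) that by (auto simp: simple_graph_def)
  have count: "finite {g \<in> G. \<tau> \<le> w g} \<and>
      real (card {g \<in> G. \<tau> \<le> w g}) \<le> C\<^sub>D * exp (2 * \<epsilon> * D) * \<tau> powr (- D)" if "\<tau> > 0" for \<tau>
    using visual_weight_count[OF G v pos(1-3) growth that] by (simp add: w_def)
  have shell: "g \<in> G \<and> t \<le> u g \<and> u g \<le> t + w g" if g: "g \<in> Sh t" for g t
  proof -
    obtain h where "(g, h) \<in> E" "u h < t" "g \<in> G" "t \<le> u g" using g symE by (auto simp: Sh_def)
    then show ?thesis using u(2)[of g h] by (auto simp: w_def)
  qed
  \<comment> \<open>Only finitely many vertices are adjacent to a vertex of weight at least \<open>\<tau>\<close>; as \<open>u\<close> is positive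
    there, a small ball avoids them all.\<close>
  have thin: "\<exists>r'>0. \<forall>t g. t \<le> r' \<longrightarrow> g \<in> Sh t \<longrightarrow> w g < \<tau>" if "\<tau> > 0" for \<tau>
  proof -
    define A where "A = {g \<in> G. \<tau> \<le> w g}"
    have fin: "finite (E `` A)" using count[OF that] finite_Image_edges[OF G(1,3)] by (auto simp: A_def)
    have "E `` A \<subseteq> G" using inG by auto
    then have "\<exists>r'>0. \<forall>h\<in>E `` A. r' \<le> u h"
    proof (cases "E `` A = {}")
      case False
      then show ?thesis using fin u(1) \<open>E `` A \<subseteq> G\<close>
        by (intro exI[of _ "Min (u ` (E `` A))"]) (auto simp: Min_gr_iff)
    qed (auto intro: exI[of _ 1])
    then obtain r' where "r' > 0" and r': "\<And>h. h \<in> E `` A \<Longrightarrow> r' \<le> u h" by blast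
    have "w g < \<tau>" if t: "t \<le> r'" "g \<in> Sh t" for t g
    proof (rule ccontr)
      assume "\<not> w g < \<tau>"
      moreover obtain h where "(g, h) \<in> E" "u h < t" "g \<in> G" using t symE by (auto simp: Sh_def)
      ultimately have "h \<in> E `` A" by (auto simp: A_def)
      then show False using r' \<open>u h < t\<close> t by fastforce
    qed
    then show ?thesis using \<open>r' > 0\<close> by blast
  qed
  obtain r' where r': "r' > 0" "\<And>t g. t \<le> r' \<Longrightarrow> g \<in> Sh t \<Longrightarrow> w g < r\<^sub>0 / 2"
    using thin[of "r\<^sub>0 / 2"] \<open>r\<^sub>0 > 0\<close> by auto
  \<comment> \<open>Below radius \<open>R\<close> the shells stay in the region where \<open>x\<close> is equal to \<open>a\<close> outside \<open>P\<close>, so that the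
    boundary mass comes from \<open>P\<close> only.\<close>
  define R where "R = min r' (r\<^sub>0 / 2)"
  have R: "R > 0" using r' \<open>r\<^sub>0 > 0\<close> by (simp add: R_def)
  have Sh_r0: "u g < r\<^sub>0" if "t < R" "g \<in> Sh t" for t g
    using shell[OF that(2)] r'(2)[of t g] that by (auto simp: R_def)
  define m where "m = min (\<mu> * (H / 2)\<^sup>2) (1 / 4 * (H / 2)\<^sup>2)"
  have "0 < m" using \<open>H > 0\<close> \<open>\<mu> > 0\<close> by (simp add: m_def)
  define K\<^sub>1 where "K\<^sub>1 = real S / (2 * \<mu>) + 1"
  define K\<^sub>2 where "K\<^sub>2 = 4 * H\<^sup>2 * (C\<^sub>0 * ((real S / 2 + 1) / m)) powr (1 + 1 / (4 * D))"
  have "0 \<le> real S / (2 * \<mu>)" using \<open>\<mu> > 0\<close> by simp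
  moreover have "0 < C\<^sub>0 * ((real S / 2 + 1) / m)" using pos \<open>0 < m\<close> by (intro mult_pos_pos divide_pos_pos) auto
  ultimately have K: "K\<^sub>1 > 0" "K\<^sub>2 > 0" "real S / (2 * \<mu>) \<le> K\<^sub>1"
    unfolding K\<^sub>1_def K\<^sub>2_def using \<open>H > 0\<close> by (auto intro!: mult_pos_pos simp del: times_divide_eq_right)
  have "C\<^sub>D * exp (2 * \<epsilon> * D) > 0" "4 * H\<^sup>2 > 0" "\<kappa>\<^sup>2 > 0" using pos \<open>H > 0\<close> \<open>\<kappa> > 0\<close> by auto
  from mass_decay_radius[OF pos(2) K(1,2) this(2,1) R this(3) count shell thin]
  obtain r where r: "r > 0" and mass: "\<And>P q. finite P \<Longrightarrow> P \<subseteq> G \<Longrightarrow> (\<forall>g. 0 \<le> q g \<and> q g \<le> 4 * H\<^sup>2) \<Longrightarrow>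
     (\<forall>t. 0 < t \<and> t < R \<longrightarrow> (\<Sum>g | g \<in> P \<and> u g < t. q g) \<le>
        K\<^sub>1 * (\<Sum>g\<in>P \<inter> Sh t. q g) + K\<^sub>2 * (\<Sum>g\<in>P \<inter> Sh t. q g) powr (1 + 1 / (4 * D))) \<Longrightarrow>
     (\<Sum>g | g \<in> P \<and> u g < r. q g) < \<kappa>\<^sup>2"
    by blast
  have "\<bar>x g - a\<bar> \<le> \<kappa>"
    if P: "finite P" "P \<subseteq> G" and x: "minimiser_on G E V P x" "\<forall>g. x g \<in> I"
      and out: "\<forall>g\<in>G - P. u g < r\<^sub>0 \<longrightarrow> x g = a" and g: "g \<in> G" "u g < min r r\<^sub>0" for P x g
  proof (cases "g \<in> P")
    case False
    then show ?thesis using out g \<open>\<kappa> > 0\<close> by auto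
  next
    case True
    have "(x h - a)\<^sup>2 \<le> 4 * H\<^sup>2" for h
      using power_mono[OF I, of "x h" 2] x(2) by (simp add: power_mult_distrib)
    moreover have "(\<Sum>g | g \<in> P \<and> u g < t. (x g - a)\<^sup>2) \<le> K\<^sub>1 * (\<Sum>g\<in>P \<inter> Sh t. (x g - a)\<^sup>2)
        + K\<^sub>2 * (\<Sum>g\<in>P \<inter> Sh t. (x g - a)\<^sup>2) powr (1 + 1 / (4 * D))" if t: "0 < t" "t < R" for t
    proof -
      define A where "A = {g. g \<in> P \<and> u g < t}"
      define s where "s = (\<Sum>g\<in>E `` A - A. (x g - a)\<^sup>2)"
      have A: "finite A" "A \<subseteq> P" using P by (auto simp: A_def)
      have "s = (\<Sum>g\<in>(E `` A - A) \<inter> (P \<inter> Sh t). (x g - a)\<^sup>2)"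
        unfolding s_def
      proof (rule sum.mono_neutral_right)
        show "finite (E `` A - A)" using finite_Image_edges[OF G(1,3) A(1)] by blast
        show "\<forall>h\<in>(E `` A - A) - (E `` A - A) \<inter> (P \<inter> Sh t). (x h - a)\<^sup>2 = 0"
        proof
          fix h assume h: "h \<in> (E `` A - A) - (E `` A - A) \<inter> (P \<inter> Sh t)"
          then obtain k where k: "(k, h) \<in> E" "u k < t" by (auto simp: A_def)
          have "h \<in> G" using inG k by blast
          have "h \<notin> P" using h k \<open>h \<in> G\<close> by (auto simp: A_def Sh_def not_less)
          moreover have "u h < r\<^sub>0"
          proof (cases "u h < t")
            case True
            then show ?thesis using t by (simp add: R_def)
          next
            case False
            then have "h \<in> Sh t" using k \<open>h \<in> G\<close> by (auto simp: Sh_def)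
            then show ?thesis using Sh_r0 t by blast
          qed
          ultimately show "(x h - a)\<^sup>2 = 0" using out \<open>h \<in> G\<close> by auto
        qed
      qed auto
      also have "\<dots> \<le> (\<Sum>g\<in>P \<inter> Sh t. (x g - a)\<^sup>2)" using P by (intro sum_mono2) auto
      finally have s: "s \<le> (\<Sum>g\<in>P \<inter> Sh t. (x g - a)\<^sup>2)" (is "s \<le> ?s") .
      have s0: "0 \<le> s" unfolding s_def by (intro sum_nonneg) auto
      have "(\<Sum>g\<in>A. (x g - a)\<^sup>2) \<le> real S / (2 * \<mu>) * s + K\<^sub>2 * s powr (1 + 1 / (4 * D))"
        unfolding K\<^sub>2_def
        using x(2) by (intro mass_le_boundary_mass[OF G x(1) A P(2) \<open>H > 0\<close> \<open>\<mu> > 0\<close> _ _ _ pos(2,4) iso m_def s_def])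
          (auto intro: V well I)
      also have "real S / (2 * \<mu>) * s \<le> K\<^sub>1 * ?s" using K s s0 by (intro mult_mono) auto
      also have "K\<^sub>2 * s powr (1 + 1 / (4 * D)) \<le> K\<^sub>2 * ?s powr (1 + 1 / (4 * D))"
        using K s s0 pos by (intro mult_left_mono powr_mono2) auto
      finally show ?thesis by (simp add: A_def)
    qed
    ultimately have "(\<Sum>g | g \<in> P \<and> u g < r. (x g - a)\<^sup>2) < \<kappa>\<^sup>2" using P by (intro mass) auto
    moreover have "(x g - a)\<^sup>2 \<le> (\<Sum>g | g \<in> P \<and> u g < r. (x g - a)\<^sup>2)"
      using P True g by (intro member_le_sum) auto
    ultimately have "\<bar>x g - a\<bar>\<^sup>2 \<le> \<kappa>\<^sup>2" by simp
    from power2_le_imp_le[OF this less_imp_le[OF \<open>\<kappa> > 0\<close>]] show ?thesis .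
  qed
  moreover have "min r r\<^sub>0 > 0" using r \<open>r\<^sub>0 > 0\<close> by simp
  ultimately show ?thesis by blast
qed

section \<open>Existence of minimisers\<close>

definition clamp_to :: "real \<Rightarrow> real \<Rightarrow> real \<Rightarrow> real" where
  "clamp_to l r s = max l (min r s)"

text \<open>
  Clamping is 1-Lipschitz and moves a value below \<open>l\<close> or above \<open>r\<close> to a global minimum point of \<open>V\<close>.
\<close>

lemma vertex_energy_clamp:
  assumes "l \<le> r" "global_min_point V l" "global_min_point V r"
    and z: "z g = clamp_to l r (y g)" "\<And>h. (g, h) \<in> E \<Longrightarrow> z h = clamp_to l r (y h)"
  shows "vertex_energy E V z g \<le> vertex_energy E V y g"
proof -
  have "V (clamp_to l r s) \<le> V s" for s
    using assms(1-3) by (auto simp: clamp_to_def global_min_point_def max_def min_def)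
  moreover have "(clamp_to l r s - clamp_to l r t)\<^sup>2 \<le> (s - t)\<^sup>2" for s t
    using assms(1) unfolding abs_le_square_iff[symmetric] clamp_to_def by (auto simp: max_def min_def)
  then have "(\<Sum>h\<in>E `` {g}. (z h - z g)\<^sup>2) \<le> (\<Sum>h\<in>E `` {g}. (y h - y g)\<^sup>2)"
    using z by (intro sum_mono) auto
  ultimately show ?thesis unfolding vertex_energy_def z(1) by (intro add_mono mult_left_mono) auto
qed

text \<open>The difference of the actions does not depend on the choice of \<open>F\<close>.\<close>

lemma action_difference_support:
  assumes G: "simple_graph G E" "connected_graph G E"
    and F: "finite F" "F \<subseteq> G" "support_nhd G E y \<subseteq> F"
  shows "action_on G E V F (\<lambda>g. x g + y g) - action_on G E V F x =
    (\<Sum>g\<in>support_nhd G E y. vertex_energy E V (\<lambda>g. x g + y g) g - vertex_energy E V x g)"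
proof -
  have "action_on G E V F (\<lambda>g. x g + y g) - action_on G E V F x =
      (\<Sum>g\<in>F. vertex_energy E V (\<lambda>g. x g + y g) g - vertex_energy E V x g)"
    by (simp add: action_on_eq[OF G F(2)] sum_subtractf)
  also have "\<dots> = (\<Sum>g\<in>support_nhd G E y. vertex_energy E V (\<lambda>g. x g + y g) g - vertex_energy E V x g)"
  proof (intro sum.mono_neutral_right F ballI)
    fix g assume g: "g \<in> F - support_nhd G E y"
    then have "g \<in> G" using F(2) by auto
    have 0: "y h = 0" if "h = g \<or> (g, h) \<in> E" for h
    proof -
      have "h \<in> G" using that \<open>g \<in> G\<close> G(1) by (auto simp: simple_graph_def)
      then show ?thesis
        using g that vdist_le_1[OF G \<open>g \<in> G\<close>, of h] \<open>g \<in> G\<close> by (auto simp: support_nhd_def)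
    qed
    then have "(\<Sum>h\<in>E `` {g}. (x h + y h - (x g + y g))\<^sup>2) = (\<Sum>h\<in>E `` {g}. (x h - x g)\<^sup>2)"
      by (intro sum.cong HOL.refl) auto
    then show "vertex_energy E V (\<lambda>g. x g + y g) g - vertex_energy E V x g = 0"
      using 0[of g] by (simp add: vertex_energy_def)
  qed
  finally show ?thesis .
qed

text \<open>Tychonoff's theorem; equal bounds \<open>l g = r g\<close> prescribe the value at \<open>g\<close>.\<close>

lemma compact_box: "compact {z :: 'a \<Rightarrow> real. \<forall>g. z g \<in> {l g..r g}}"
proof -
  have "compactin (product_topology (\<lambda>_. euclidean) UNIV) (PiE UNIV (\<lambda>g. {l g..r g}))"
    by (subst compactin_PiE) auto
  moreover have "PiE UNIV (\<lambda>g. {l g..r g}) = {z. \<forall>g. z g \<in> {l g..r g}}" by (auto simp: PiE_def)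
  ultimately show ?thesis by (simp add: euclidean_product_topology)
qed

lemma continuous_on_vertex_energy:
  assumes "continuous_on UNIV V"
  shows "continuous_on UNIV (\<lambda>x. vertex_energy E V (\<lambda>g. x g + y g) g)"
proof -
  have "continuous_on UNIV (\<lambda>x :: 'a \<Rightarrow> real. V (x g + y g))" for g
    by (rule continuous_on_compose2[OF assms]) (auto intro!: continuous_intros)
  then show ?thesis unfolding vertex_energy_def by (intro continuous_intros) auto
qed

text \<open>
  The minimum is taken over functions with values in \<open>{l..r}\<close>, where it exists by compactness. An arbitrary
  competitor is clamped to that interval, which leaves the boundary values alone.
\<close>

lemma minimiser_on_exists:
  fixes V :: "real \<Rightarrow> real"
  assumes G: "simple_graph G E" "connected_graph G E" "degree_at_most S G E"
    and P: "finite P" "P \<subseteq> G"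
    and V: "continuous_on UNIV V" "global_min_point V l" "global_min_point V r" "l \<le> r"
    and b: "\<And>g. b g \<in> {l..r}"
  shows "\<exists>x. minimiser_on G E V P x \<and> (\<forall>g. x g \<in> {l..r}) \<and> (\<forall>g. g \<notin> P \<longrightarrow> x g = b g)"
proof -
  define Z where "Z = {z. \<forall>g. z g \<in> {(if g \<in> P then l else b g)..(if g \<in> P then r else b g)}}"
  define F where "F = P \<union> E `` P"
  have F: "finite F" "F \<subseteq> G"
    using P finite_Image_edges[OF G(1,3) P(1)] G(1) by (auto simp: F_def simple_graph_def)
  have "continuous_on Z (\<lambda>z. \<Sum>g\<in>F. vertex_energy E V z g)"
  proof (rule continuous_on_sum)
    show "continuous_on Z (\<lambda>z. vertex_energy E V z g)" for g
      using continuous_on_subset[OF continuous_on_vertex_energy[OF V(1), of E "\<lambda>_. 0"] subset_UNIV] by simp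
  qed
  moreover have "compact Z" unfolding Z_def by (rule compact_box)
  moreover have "(\<lambda>g. if g \<in> P then l else b g) \<in> Z" using V(4) by (auto simp: Z_def)
  ultimately obtain x where x: "x \<in> Z" 
      "\<And>z. z \<in> Z \<Longrightarrow> (\<Sum>g\<in>F. vertex_energy E V x g) \<le> (\<Sum>g\<in>F. vertex_energy E V z g)"
    using continuous_attains_inf[of Z "\<lambda>z. \<Sum>g\<in>F. vertex_energy E V z g"] by blast
  have xb: "x g \<in> {l..r}" "g \<notin> P \<Longrightarrow> x g = b g" for g
  proof -
    have "x g \<in> {(if g \<in> P then l else b g)..(if g \<in> P then r else b g)}" using x(1) by (simp add: Z_def)
    then show "x g \<in> {l..r}" "g \<notin> P \<Longrightarrow> x g = b g" using b[of g] by (auto split: if_splits)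
  qed
  have "0 \<le> action_on G E V F' (\<lambda>g. x g + y g) - action_on G E V F' x"
    if y: "{g \<in> G. y g \<noteq> 0} \<subseteq> P" and F': "finite F'" "F' \<subseteq> G" "support_nhd G E y \<subseteq> F'" for y F'
  proof -
    define z where "z g = (if g \<in> P then clamp_to l r (x g + y g) else b g)" for g
    have "z \<in> Z" using V(4) by (auto simp: Z_def z_def clamp_to_def)
    have z: "z g = clamp_to l r (x g + y g)" if "g \<in> G" for g
    proof (cases "g \<in> P")
      case False
      then have "y g = 0" "x g = b g" using y that xb by auto
      then show ?thesis using b[of g] False by (auto simp: z_def clamp_to_def)
    qed (simp add: z_def)
    have "support_nhd G E y \<subseteq> F"
    proof
      fix g assume "g \<in> support_nhd G E y"
      then obtain h where h: "g \<in> G" "h \<in> G" "y h \<noteq> 0" "vdist G E g h \<le> 1" by (auto simp: support_nhd_def)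
      then have "h \<in> P" using y by auto
      moreover have "g = h \<or> (h, g) \<in> E" using vdist_le_1[OF G(1,2) h(2,1)] h(4) vdist_sym[of G E g h] by auto
      ultimately show "g \<in> F" by (auto simp: F_def)
    qed
    have "(\<Sum>g\<in>F. vertex_energy E V x g) \<le> (\<Sum>g\<in>F. vertex_energy E V z g)"
      by (rule x(2)) fact
    also have "\<dots> \<le> (\<Sum>g\<in>F. vertex_energy E V (\<lambda>g. x g + y g) g)"
    proof (rule sum_mono)
      fix g assume "g \<in> F"
      then have "g \<in> G" using F by auto
      moreover have "h \<in> G" if "(g, h) \<in> E" for h using G(1) that by (auto simp: simple_graph_def)
      ultimately show "vertex_energy E V z g \<le> vertex_energy E V (\<lambda>g. x g + y g) g"
        using z by (intro vertex_energy_clamp[OF V(4,2,3)]) auto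
    qed
    finally have "0 \<le> action_on G E V F (\<lambda>g. x g + y g) - action_on G E V F x"
      by (simp add: action_on_eq[OF G(1,2) F(2)])
    then show ?thesis
      using action_difference_support[OF G(1,2) F \<open>support_nhd G E y \<subseteq> F\<close>, of V x]
        action_difference_support[OF G(1,2) F', of V x] by simp
  qed
  then show ?thesis unfolding minimiser_on_def using xb by blast
qed

lemma closed_minimiser_on:
  assumes G: "simple_graph G E" "connected_graph G E" and V: "continuous_on UNIV V"
  shows "closed {x. minimiser_on G E V P x}"
proof -
  have "closed {x. 0 \<le> action_on G E V F (\<lambda>g. x g + y g) - action_on G E V F x}" if "F \<subseteq> G" for y F
  proof -
    have "continuous_on UNIV (\<lambda>x. action_on G E V F (\<lambda>g. x g + y g))" for y
      unfolding action_on_eq[OF G that] by (intro continuous_on_sum continuous_on_vertex_energy V)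
    from this[of y] this[of "\<lambda>_. 0"] show ?thesis
      by (intro closed_Collect_le continuous_on_diff continuous_on_const) simp_all
  qed
  then have "closed (\<Inter>(y, F)\<in>{(y, F). {g \<in> G. y g \<noteq> 0} \<subseteq> P \<and> finite F \<and> F \<subseteq> G \<and> support_nhd G E y \<subseteq> F}.
      {x. 0 \<le> action_on G E V F (\<lambda>g. x g + y g) - action_on G E V F x})"
    by (intro closed_INT) auto
  moreover have "{x. minimiser_on G E V P x} =
    (\<Inter>(y, F)\<in>{(y, F). {g \<in> G. y g \<noteq> 0} \<subseteq> P \<and> finite F \<and> F \<subseteq> G \<and> support_nhd G E y \<subseteq> F}.
      {x. 0 \<le> action_on G E V F (\<lambda>g. x g + y g) - action_on G E V F x})"
    unfolding minimiser_on_def by (simp add: set_eq_iff) blast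
  ultimately show ?thesis by simp
qed

text \<open>
  The conditions for the various \<open>P\<close> are closed and directed, so the finite intersection property
  replaces the choice of a convergent subsequence.
\<close>

lemma global_minimiser_from_finite:
  fixes V :: "real \<Rightarrow> real"
  assumes G: "simple_graph G E" "connected_graph G E" and V: "continuous_on UNIV V"
    and "closed C"
    and ex: "\<And>P. finite P \<Longrightarrow> P \<subseteq> G \<Longrightarrow> \<exists>x\<in>C. (\<forall>g. x g \<in> {l..r}) \<and> minimiser_on G E V P x"
  shows "\<exists>x\<in>C. global_minimiser G E V x"
proof -
  define box where "box = {x :: 'a \<Rightarrow> real. \<forall>g. x g \<in> {l..r}}"
  have mono: "minimiser_on G E V P x" if "minimiser_on G E V P' x" "P \<subseteq> P'" for P P' x
    using that unfolding minimiser_on_def by (meson order_trans)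
  have "box \<inter> (\<Inter>P\<in>{P. finite P \<and> P \<subseteq> G}. C \<inter> {x. minimiser_on G E V P x}) \<noteq> {}"
  proof (rule compact_imp_fip_image)
    show "compact box" unfolding box_def by (rule compact_box)
    show "closed (C \<inter> {x. minimiser_on G E V P x})" for P
      using \<open>closed C\<close> closed_minimiser_on[OF G V] by blast
    fix \<P> assume \<P>: "finite \<P>" "\<P> \<subseteq> {P. finite P \<and> P \<subseteq> G}"
    then obtain x where "x \<in> C" "x \<in> box" "minimiser_on G E V (\<Union>\<P>) x"
      using ex[of "\<Union>\<P>"] by (auto simp: box_def)
    then show "box \<inter> (\<Inter>P\<in>\<P>. C \<inter> {x. minimiser_on G E V P x}) \<noteq> {}"
      using mono by blast
  qed
  then obtain x where "x \<in> (\<Inter>P\<in>{P. finite P \<and> P \<subseteq> G}. C \<inter> {x. minimiser_on G E V P x})" by blast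
  then have x: "x \<in> C \<and> minimiser_on G E V P x" if "finite P" "P \<subseteq> G" for P using that by blast
  have "global_minimiser G E V x" unfolding global_minimiser_def
  proof (intro allI impI)
    fix y F assume "finite {g \<in> G. y g \<noteq> 0}" "finite F" "F \<subseteq> G" "support_nhd G E y \<subseteq> F"
    then show "0 \<le> action_on G E V F (\<lambda>g. x g + y g) - action_on G E V F x"
      using x[of "{g \<in> G. y g \<noteq> 0}"] unfolding minimiser_on_def by auto
  qed
  then show ?thesis using x[of "{}"] by auto
qed

lemma visual_extension_edge:
  assumes G: "simple_graph G E" "connected_graph G E" and "v \<in> G" "\<epsilon> > 0"
    and \<rho>: "visual_extension G E v \<epsilon> \<rho>" and \<xi>: "\<xi> \<in> boundary G E" and gh: "(g, h) \<in> E"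
  shows "\<bar>\<rho> (Inr \<xi>) (Inl (vert g)) - \<rho> (Inr \<xi>) (Inl (vert h))\<bar> \<le> exp \<epsilon> * exp (- \<epsilon> * vdist G E v g)"
proof -
  interpret Metric_space "compactification G E" \<rho> using \<rho> by (simp add: visual_extension_def)
  have "g \<in> G" "h \<in> G" using G(1) gh by (auto simp: simple_graph_def)
  then have mem: "Inr \<xi> \<in> compactification G E" "Inl (vert g) \<in> compactification G E"
      "Inl (vert h) \<in> compactification G E"
    using \<xi> by (auto simp: compactification_def vert_in_metric_graph)
  have "\<bar>\<rho> (Inr \<xi>) (Inl (vert g)) - \<rho> (Inr \<xi>) (Inl (vert h))\<bar> \<le> \<rho> (Inl (vert g)) (Inl (vert h))"
    using triangle[OF mem] triangle[OF mem(1,3,2)] commute[of "Inl (vert g)" "Inl (vert h)"] by linarith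
  also have "\<dots> = visual_dist G E v \<epsilon> (vert g) (vert h)"
    using \<rho> \<open>g \<in> G\<close> \<open>h \<in> G\<close> by (simp add: visual_extension_def vert_in_metric_graph)
  finally show ?thesis using visual_dist_edge[OF G gh \<open>v \<in> G\<close> \<open>\<epsilon> > 0\<close>] by linarith
qed

section \<open>Minimisers with prescribed values at infinity\<close>

theorem mainTheorem1:
  fixes G :: "'a set" and E :: "('a \<times> 'a) set" and S :: nat and v :: 'a
    and \<delta> \<delta>' \<epsilon> L D C\<^sub>D C\<^sub>0 :: real
    and \<rho> :: "'a point + 'a bpoint \<Rightarrow> 'a point + 'a bpoint \<Rightarrow> real"
    and V :: "real \<Rightarrow> real" and c :: "nat \<Rightarrow> real" and \<D> :: "nat \<Rightarrow> 'a bpoint set"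
  assumes "simple_graph G E" and "infinite G" and "connected_graph G E"
    and "degree_at_most S G E"
    and "\<delta> > 0" and "hyperbolic \<delta> G E"
    and "v \<in> G" and "\<delta>' > 0" and "coarsely_covered_by_rays G E v \<delta>'"
    and "\<epsilon> > 0" and "visual_extension G E v \<epsilon> \<rho>"
    and "L > 0" and "visual_estimate G E v \<epsilon> L \<rho>"
    and "D > 0" and "C\<^sub>D > 0"
    and "\<forall>n. real (card (vball G E v n)) \<le> C\<^sub>D * exp (\<epsilon> * real n * D)"
    and "C\<^sub>0 \<ge> 1"
    and "\<forall>B. finite B \<and> B \<subseteq> G \<longrightarrow>
           C\<^sub>0 * real (card (outer_boundary G E B)) \<ge> real (card B) powr (4 * D / (4 * D + 1))"
    and "C2 V" and "consecutive_nondegenerate_minima V (c 0) (c 1)"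
    and "\<D> 0 \<subseteq> boundary G E" and "\<D> 1 \<subseteq> boundary G E"
    and "boundary_topology G E \<rho> closure_of (\<D> 0 \<union> \<D> 1) = boundary G E"
    and "boundary_topology G E \<rho> interior_of \<D> 0 \<inter> boundary_topology G E \<rho> interior_of \<D> 1 = {}"
    and "\<forall>j\<in>{0, 1}.
           boundary_topology G E \<rho> closure_of (boundary_topology G E \<rho> interior_of \<D> j) = \<D> j"
  shows "\<exists>x. global_minimiser G E V x \<and>
    (\<forall>\<kappa>>0. \<forall>j\<in>{0, 1}. \<exists>\<O>.
       openin (compactification_topology G E \<rho>) \<O> \<and>
       Inr ` (boundary_topology G E \<rho> interior_of \<D> j) \<subseteq> \<O> \<and>
       (\<forall>g\<in>G. Inl (vert g) \<in> \<O> \<longrightarrow> \<bar>x g - c j\<bar> \<le> \<kappa>))"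
proof -
  note G = assms(1,3,4)
  interpret Metric_space "compactification G E" \<rho> using assms(11) by (simp add: visual_extension_def)
  let ?bd = "\<lambda>\<xi> \<mu>. \<rho> (Inr \<xi>) (Inr \<mu>)"
  interpret bd: Metric_space "boundary G E" ?bd
  proof
    fix \<xi> \<mu> \<nu>
    show "0 \<le> ?bd \<xi> \<mu>" by simp
    show "?bd \<xi> \<mu> = ?bd \<mu> \<xi>" by (rule commute)
    assume mem: "\<xi> \<in> boundary G E" "\<mu> \<in> boundary G E"
    then have "Inr \<xi> \<in> compactification G E" "Inr \<mu> \<in> compactification G E"
      by (auto simp: compactification_def)
    then show "(?bd \<xi> \<mu> = 0) = (\<xi> = \<mu>)" by simp
    assume "\<nu> \<in> boundary G E"
    then show "?bd \<xi> \<nu> \<le> ?bd \<xi> \<mu> + ?bd \<mu> \<nu>" 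
      using mem by (intro triangle) (auto simp: compactification_def)
  qed
  define \<I> where I_def:  "\<I> j = boundary_topology G E \<rho> interior_of \<D> j" for j
  define dst where "dst \<xi> g = \<rho> (Inr \<xi>) (Inl (vert g))" for \<xi> g
  have mem: "Inr \<xi> \<in> compactification G E" if "\<xi> \<in> boundary G E" for \<xi>
    using that by (auto simp: compactification_def)
  have memv: "Inl (vert g) \<in> compactification G E" if "g \<in> G" for g
    using that by (auto simp: compactification_def vert_in_metric_graph)
  have I_sub: "\<I> j \<subseteq> boundary G E" for j
    unfolding I_def boundary_topology_def using interior_of_subset_topspace by force
  define rad where "rad j \<xi> = (SOME r. r > 0 \<and> bd.mball \<xi> (2 * r) \<subseteq> \<I> j)" for j \<xi>
  have rad: "rad j \<xi> > 0 \<and> bd.mball \<xi> (2 * rad j \<xi>) \<subseteq> \<I> j" if "\<xi> \<in> \<I> j" for \<xi> j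
  proof -
    have "openin bd.mtopology (\<I> j)" unfolding I_def boundary_topology_def by simp
    then obtain r where "r > 0" "bd.mball \<xi> r \<subseteq> \<I> j" using \<open>\<xi> \<in> \<I> j\<close> by (auto simp: bd.openin_mtopology)
    then have "r / 2 > 0 \<and> bd.mball \<xi> (2 * (r / 2)) \<subseteq> \<I> j" by simp
    then show ?thesis unfolding rad_def by (rule someI)
  qed
  \<comment> \<open>The boundary data \<open>b\<close> are \<open>c j\<close> near every interior point of \<open>\<D> j\<close>. There is no conflict: if a
    vertex is in both neighbourhoods, then the two centres have distance less than twice the larger
    radius, and one of them lies in both interiors.\<close>
  define b where "b g = (if \<exists>\<xi>\<in>\<I> 0. dst \<xi> g < rad 0 \<xi> then c 0 else c 1)" for g
  have b: "b g = c j" if g: "g \<in> G" and j: "j \<in> {0, 1}" "\<xi> \<in> \<I> j" "dst \<xi> g < rad j \<xi>" for g j \<xi>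
  proof -
    have False if \<mu>: "\<mu> \<in> \<I> 0" "dst \<mu> g < rad 0 \<mu>" and \<xi>: "\<xi> \<in> \<I> 1" "dst \<xi> g < rad 1 \<xi>" for \<mu> \<xi>
    proof -
      have bdry: "\<mu> \<in> boundary G E" "\<xi> \<in> boundary G E" using \<mu> \<xi> I_sub by auto
      have "?bd \<mu> \<xi> \<le> dst \<mu> g + dst \<xi> g"
        unfolding dst_def using triangle[OF mem[OF bdry(1)] memv[OF g] mem[OF bdry(2)]] by (simp add: commute)
      then have "?bd \<mu> \<xi> < 2 * rad 0 \<mu> \<or> ?bd \<xi> \<mu> < 2 * rad 1 \<xi>"
        using \<mu> \<xi> commute[of "Inr \<mu>" "Inr \<xi>"] by linarith
      then have "\<xi> \<in> \<I> 0 \<or> \<mu> \<in> \<I> 1"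
        using rad[OF \<mu>(1)] rad[OF \<xi>(1)] bdry by auto
      then show False using \<mu> \<xi> assms(24) unfolding I_def by blast
    qed
    then show ?thesis using j by (auto simp: b_def)
  qed
  define H where "H = (c 1 - c 0) / 2"
  note V = assms(20)[unfolded consecutive_nondegenerate_minima_def]
  have H: "H > 0" "c 1 = c 0 + 2 * H" using V by (simp_all add: H_def field_simps)
  have Vj: "global_min_point V (c j)" if "j \<in> {0, 1}" for j using V that by auto
  have Vc: "continuous_on UNIV V"
    using assms(19) by (auto simp: C2_def intro!: continuous_at_imp_continuous_on differentiable_imp_continuous_within)
  have well: "\<exists>\<mu>>0. \<forall>s\<in>{c 0..c 1}. \<bar>s - c j\<bar> \<le> H \<longrightarrow> \<mu> * (s - c j)\<^sup>2 \<le> V s - V (c j)" if j: "j \<in> {0, 1}" for j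
  proof -
    \<comment> \<open>The half of the interval that is adjacent to \<open>c j\<close>, on which \<open>c j\<close> is the only minimum point.\<close>
    define l where "l = (if j = 0 then c 0 else c 0 + H)"
    have "\<exists>\<mu>>0. \<forall>s\<in>{l..l + H}. \<mu> * (s - c j)\<^sup>2 \<le> V s - V (c j)"
    proof (rule well_quadratic_growth[OF assms(19)])
      show "global_min_point V (c j)" "deriv (deriv V) (c j) \<noteq> 0" using V j by auto
      show "c j \<in> {l..l + H}" using j H by (auto simp: l_def)
      fix s assume s: "s \<in> {l..l + H}" "global_min_point V s"
      then have "\<not> (c 0 < s \<and> s < c 1)" using V by blast
      then show "s = c j" using s(1) j H by (auto simp: l_def split: if_splits)
    qed
    moreover have "s \<in> {l..l + H}" if "s \<in> {c 0..c 1}" "\<bar>s - c j\<bar> \<le> H" for s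
      using that j H by (auto simp: l_def)
    ultimately show ?thesis by blast
  qed
  have radius: "\<exists>r>0. \<forall>P x. finite P \<longrightarrow> P \<subseteq> G \<longrightarrow> minimiser_on G E V P x \<longrightarrow> (\<forall>g. x g \<in> {c 0..c 1}) \<longrightarrow>
      (\<forall>g\<in>G - P. dst \<xi> g < rad j \<xi> \<longrightarrow> x g = c j) \<longrightarrow> (\<forall>g\<in>G. dst \<xi> g < r \<longrightarrow> \<bar>x g - c j\<bar> \<le> \<kappa>)"
    if j: "j \<in> {0, 1}" and \<xi>: "\<xi> \<in> \<I> j" and "\<kappa> > 0" for j \<xi> \<kappa>
  proof -
    obtain \<mu> where \<mu>: "\<mu> > 0" "\<And>s. s \<in> {c 0..c 1} \<Longrightarrow> \<bar>s - c j\<bar> \<le> H \<Longrightarrow> \<mu> * (s - c j)\<^sup>2 \<le> V s - V (c j)"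
      using well[OF j] by blast
    have bdry: "\<xi> \<in> boundary G E" using \<xi> I_sub by auto
    have "C\<^sub>0 > 0" using assms(17) by simp
    show ?thesis
    proof (rule minimiser_decay_radius[OF G assms(7,10,14,15) \<open>C\<^sub>0 > 0\<close> assms(16) _ H(1) \<mu>(1) _ \<mu>(2)])
      show "real (card B) powr (4 * D / (4 * D + 1)) \<le> C\<^sub>0 * real (card (outer_boundary G E B))"
        if "finite B" "B \<subseteq> G" for B using assms(18) that by simp
      show "V (c j) \<le> V s" for s using Vj[OF j] by (simp add: global_min_point_def)
      show "\<bar>s - c j\<bar> \<le> 2 * H" if "s \<in> {c 0..c 1}" for s using that j H by auto
      show "0 < dst \<xi> g" if "g \<in> G" for g
        unfolding dst_def using mem[OF bdry] memv[OF that] by (simp add: mdist_pos_less)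
      show "\<bar>dst \<xi> g - dst \<xi> h\<bar> \<le> exp \<epsilon> * exp (- \<epsilon> * vdist G E v g)" if "(g, h) \<in> E" for g h
        unfolding dst_def by (rule visual_extension_edge[OF G(1,2) assms(7,10,11) bdry that])
      show "rad j \<xi> > 0" using rad[OF \<xi>] by simp
    qed (use \<open>\<kappa> > 0\<close> in auto)
  qed
  \<comment> \<open>The radii do not depend on \<open>P\<close> and \<open>x\<close>, so the decay is a set \<open>C\<close> of closed conditions that is the same
    for all finite approximations.\<close>
  define good where "good j \<xi> \<kappa> r \<longleftrightarrow> r > 0 \<and> (\<forall>P x. finite P \<longrightarrow> P \<subseteq> G \<longrightarrow> minimiser_on G E V P x \<longrightarrow>
      (\<forall>g. x g \<in> {c 0..c 1}) \<longrightarrow> (\<forall>g\<in>G - P. dst \<xi> g < rad j \<xi> \<longrightarrow> x g = c j) \<longrightarrow>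
      (\<forall>g\<in>G. dst \<xi> g < r \<longrightarrow> \<bar>x g - c j\<bar> \<le> \<kappa>))" for j \<xi> \<kappa> r
  define decay_rad where "decay_rad j \<xi> \<kappa> = (SOME r. good j \<xi> \<kappa> r)" for j \<xi> \<kappa>
  have decay_rad: "good j \<xi> \<kappa> (decay_rad j \<xi> \<kappa>)" if "j \<in> {0, 1}" "\<xi> \<in> \<I> j" "\<kappa> > 0" for j \<xi> \<kappa>
    unfolding decay_rad_def by (rule someI_ex) (use radius[OF that] in \<open>simp add: good_def\<close>)
  define C where "C = (\<Inter>(j, \<xi>, \<kappa>, g)\<in>{(j, \<xi>, \<kappa>, g). j \<in> {0, 1} \<and> \<xi> \<in> \<I> j \<and> \<kappa> > 0 \<and> g \<in> G \<and> dst \<xi> g < decay_rad j \<xi> \<kappa>}.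
      {x. \<bar>x g - c j\<bar> \<le> \<kappa>})"
  have C: "\<bar>x g - c j\<bar> \<le> \<kappa>"
    if "x \<in> C" "j \<in> {0, 1}" "\<xi> \<in> \<I> j" "\<kappa> > 0" "g \<in> G" "dst \<xi> g < decay_rad j \<xi> \<kappa>" for x j \<xi> \<kappa> g
    using that unfolding C_def by blast
  have "\<exists>x\<in>C. global_minimiser G E V x"
  proof (rule global_minimiser_from_finite[OF G(1,2) Vc])
    show "closed C" unfolding C_def
      by (intro closed_INT ballI) (auto split: prod.splits intro!: closed_Collect_le continuous_intros)
    fix P assume P: "finite P" "P \<subseteq> G"
    have "b g \<in> {c 0..c 1}" for g using H by (auto simp: b_def)
    then obtain x where x: "minimiser_on G E V P x" "\<forall>g. x g \<in> {c 0..c 1}" "\<forall>g. g \<notin> P \<longrightarrow> x g = b g"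
      using minimiser_on_exists[OF G P Vc Vj Vj, of 0 1 b] H by auto
    have "x \<in> C"
      unfolding C_def
    proof clarify
      fix j \<xi> \<kappa> g assume *: "j \<in> {0, 1}" "\<xi> \<in> \<I> j" "0 < \<kappa>" "g \<in> G" "dst \<xi> g < decay_rad j \<xi> \<kappa>"
      have "\<forall>g\<in>G - P. dst \<xi> g < rad j \<xi> \<longrightarrow> x g = c j" using x(3) b[OF _ *(1,2)] by auto
      then show "\<bar>x g - c j\<bar> \<le> \<kappa>" using decay_rad[OF *(1-3), unfolded good_def] P x(1,2) *(4,5) by simp
    qed
    then show "\<exists>x\<in>C. (\<forall>g. x g \<in> {c 0..c 1}) \<and> minimiser_on G E V P x" using x by blast
  qed
  then obtain x where x: "x \<in> C" "global_minimiser G E V x" by blast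
  have "\<exists>\<O>. openin (compactification_topology G E \<rho>) \<O> \<and> Inr ` \<I> j \<subseteq> \<O> \<and>
      (\<forall>g\<in>G. Inl (vert g) \<in> \<O> \<longrightarrow> \<bar>x g - c j\<bar> \<le> \<kappa>)" if "\<kappa> > 0" and j: "j \<in> {0, 1}" for \<kappa> j
  proof (intro exI conjI)
    let ?O = "\<Union>\<xi>\<in>\<I> j. mball (Inr \<xi>) (decay_rad j \<xi> \<kappa>)"
    show "openin (compactification_topology G E \<rho>) ?O"
      unfolding compactification_topology_def by blast
    show "Inr ` \<I> j \<subseteq> ?O"
    proof (rule image_subsetI)
      fix \<xi> assume \<xi>: "\<xi> \<in> \<I> j"
      then have "decay_rad j \<xi> \<kappa> > 0" using decay_rad[OF j \<xi> \<open>\<kappa> > 0\<close>] by (simp add: good_def)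
      moreover have "\<xi> \<in> boundary G E" using I_sub \<xi> by blast
      ultimately have "Inr \<xi> \<in> mball (Inr \<xi>) (decay_rad j \<xi> \<kappa>)" using mem by simp
      then show "Inr \<xi> \<in> ?O" using \<xi> by blast
    qed
    show "\<forall>g\<in>G. Inl (vert g) \<in> ?O \<longrightarrow> \<bar>x g - c j\<bar> \<le> \<kappa>"
      using C[OF x(1) j _ \<open>\<kappa> > 0\<close>] by (auto simp: dst_def)
  qed
  then show ?thesis using x(2) unfolding I_def by blast
qed

end
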